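(* Let $m\ge1$ be an integer, $p$ a prime, and $S$ a matrix as in the context with $s_{0,1}s_{1,2}\cdots s_{m-1,m}\ne0$. Let $\mathcal F_k=\{F_{k,0},\ldots,F_{k,m}\}\in\mathfrak F(S,m)$, $k=1,2,\ldots$, be a sequence of (not necessarily distinct) permutation polynomial systems over $\mathbb F_p$, and let $F_i^{(k)}$ be the polynomials defined by $$F_i^{(0)}=X_i,\qquad F_i^{(k)}=F_{k,i}\big(F_0^{(k-1)},\ldots,F_m^{(k-1)}\big),\quad k=1,2,\ldots,\ i=0,\ldots,m.$$ Then for any positive integers $c,M,N$ and any nonzero vector $\mathbf a=(a_0,\ldots,a_{m-1})\in\mathbb F_p^m$, $$\sum_{w_0,\ldots,w_m\in\mathbb F_p}\left|\sum_{n=0}^{N-1}\mathbf e_p\Big(\sum_{j=0}^{m-1}a_jF_j^{(n)}(w_0,\ldots,w_m)\Big)\mathbf e_M(cn)\right|^2\ll A(N,p),$$ where $$A(N,p)=\begin{cases}Np^{m+1}&\text{if }N\le p^{1/(m+1)},\\ N^2p^{m(m+2)/(m+1)}&\text{if }N>p^{1/(m+1)},\end{cases}$$ and the implied constant depends only on $S$ and $m$.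
   Context: $\mathbf e_M(z)=\exp(2\pi iz/M)$ for a positive integer $M$, in particular $\mathbf e_p(z)=\exp(2\pi iz/p)$. The field $\mathbb F_p$ is represented by $\{0,1,\ldots,p-1\}$, so its elements are also regarded as integers. $A\ll B$ means $|A|\le cB$ for some constant $c>0$. $S$ is an integral upper triangular $(m+1)\times(m+1)$ matrix, rows and columns indexed by $0,\ldots,m$, with ones on the diagonal and entries $s_{i,j}$ for $0\le i<j\le m$ (used as exponents, hence non-negative). $\mathfrak F(S,m)$ is the set of all systems $\{F_0,\ldots,F_m\}$ of polynomials in $\mathbb F_p[X_0,\ldots,X_m]$ of the form $$F_i=X_iG_i(X_{i+1},\ldots,X_m)+H_i(X_{i+1},\ldots,X_m)\quad (0\le i\le m-1),\qquad F_m=g_mX_m+h_m,$$ with $g_m,h_m\in\mathbb F_p$, $g_m\ne0$, $G_i,H_i\in\mathbb F_p[X_{i+1},\ldots,X_m]$, where for $0\le i\le m-1$ $$G_i=g_iX_{i+1}^{s_{i,i+1}}\cdots X_m^{s_{i,m}}+\widetilde G_i,\qquad g_i\in\mathbb F_p^*,$$ and $\deg_{X_j}\widetilde G_i<s_{i,j}$, $\deg_{X_j}H_i\le s_{i,j}$ for $j=i+1,\ldots,m$ (the zero polynomial has degree $-\infty$). A system $\{F_0,\ldots,F_m\}$ is a permutation polynomial system if the map $\mathbf w\mapsto(F_0(\mathbf w),\ldots,F_m(\mathbf w))$ is a bijection of $\mathbb F_p^{m+1}$. *)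

theory Defs
  imports
    Complex_Main
    "HOL-Computational_Algebra.Primes"
    "HOL-Library.FuncSet"
    "HOL-Library.Extended_Real"
    "HOL-Library.Poly_Mapping"
    "Jordan_Normal_Form.Matrix"
begin

text \<open>
  The prime \<open>p\<close> is a term rather than a type parameter, because the bounds are uniform in \<open>p\<close>.
  The field of \<open>p\<close> elements is therefore represented by the integers \<open>0, \<dots>, p - 1\<close>, and a
  polynomial over it by an integer polynomial with coefficients in that range.  The field and
  polynomial operations are the integer ones followed by reduction modulo \<open>p\<close>.
\<close>

definition Fp :: "nat \<Rightarrow> int set" where
  "Fp p = {0..<int p}"

text \<open>
  A monomial is a finitely supported map from variable indices to exponents, a polynomial a
  finitely supported map from monomials to coefficients; the type below is a commutative ring.
\<close>

type_synonym int_mpoly = "(nat \<Rightarrow>\<^sub>0 nat) \<Rightarrow>\<^sub>0 int"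

definition Const :: "int \<Rightarrow> int_mpoly" where
  "Const c = Poly_Mapping.single 0 c"

definition Var :: "nat \<Rightarrow> int_mpoly" where
  "Var i = Poly_Mapping.single (Poly_Mapping.single i 1) 1"

definition Fp_polys :: "nat \<Rightarrow> nat set \<Rightarrow> int_mpoly set" where
  "Fp_polys p V = {P. (\<forall>t. Poly_Mapping.lookup P t \<in> Fp p) \<and>
                      (\<forall>t \<in> Poly_Mapping.keys P. Poly_Mapping.keys t \<subseteq> V)}"

definition reduce :: "nat \<Rightarrow> int_mpoly \<Rightarrow> int_mpoly" where
  "reduce p P = Poly_Mapping.map (\<lambda>c. c mod int p) P"

text \<open>The supremum of the empty set is \<open>-\<infinity>\<close>, so this is the degree of the zero polynomial.\<close>

definition deg_in :: "nat \<Rightarrow> int_mpoly \<Rightarrow> ereal" where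
  "deg_in j P = (SUP t \<in> Poly_Mapping.keys P. ereal (real (Poly_Mapping.lookup t j)))"

text \<open>
  Substitution into an integer polynomial, with values in an arbitrary commutative ring; used
  both for evaluation at points and for composition of polynomials.
\<close>

definition insertion :: "(nat \<Rightarrow> 'b::comm_ring_1) \<Rightarrow> int_mpoly \<Rightarrow> 'b" where
  "insertion x P = (\<Sum>t \<in> Poly_Mapping.keys P. of_int (Poly_Mapping.lookup P t) *
      (\<Prod>i \<in> Poly_Mapping.keys t. x i ^ Poly_Mapping.lookup t i))"

definition Fp_eval :: "nat \<Rightarrow> int_mpoly \<Rightarrow> (nat \<Rightarrow> int) \<Rightarrow> int" where
  "Fp_eval p P w = insertion w P mod int p"

definition Fp_comp :: "nat \<Rightarrow> int_mpoly \<Rightarrow> (nat \<Rightarrow> int_mpoly) \<Rightarrow> int_mpoly" where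
  "Fp_comp p P Q = reduce p (insertion Q P)"

definition Fp_points :: "nat \<Rightarrow> nat \<Rightarrow> (nat \<Rightarrow> int) set" where
  "Fp_points p m = {..m} \<rightarrow>\<^sub>E Fp p"

text \<open>Rows and columns are indexed by \<open>0, \<dots>, m\<close>.\<close>

definition exponent_matrix :: "nat mat \<Rightarrow> nat \<Rightarrow> bool" where
  "exponent_matrix S m \<longleftrightarrow>
     S \<in> carrier_mat (m + 1) (m + 1) \<and> upper_triangular S \<and> (\<forall>i\<le>m. S $$ (i, i) = 1)"

text \<open>
  A system is a family of polynomials of which only the members with index at most \<open>m\<close> matter.
\<close>

definition poly_systems :: "nat \<Rightarrow> nat mat \<Rightarrow> nat \<Rightarrow> (nat \<Rightarrow> int_mpoly) set" where
  "poly_systems p S m = {F.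
     (\<forall>i<m. \<exists>G H g Gt.
        G \<in> Fp_polys p {i<..m} \<and> H \<in> Fp_polys p {i<..m} \<and> Gt \<in> Fp_polys p {i<..m} \<and>
        g \<in> Fp p \<and> g \<noteq> 0 \<and>
        F i = reduce p (Var i * G + H) \<and>
        G = reduce p (Const g * (\<Prod>j\<in>{i<..m}. Var j ^ (S $$ (i, j))) + Gt) \<and>
        (\<forall>j\<in>{i<..m}. deg_in j Gt < ereal (real (S $$ (i, j))) \<and>
                       deg_in j H \<le> ereal (real (S $$ (i, j))))) \<and>
     (\<exists>g h. g \<in> Fp p \<and> h \<in> Fp p \<and> g \<noteq> 0 \<and> F m = reduce p (Const g * Var m + Const h))}"

definition permutation_system :: "nat \<Rightarrow> nat \<Rightarrow> (nat \<Rightarrow> int_mpoly) \<Rightarrow> bool" where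
  "permutation_system p m F \<longleftrightarrow>
     bij_betw (\<lambda>w. \<lambda>i\<in>{..m}. Fp_eval p (F i) w) (Fp_points p m) (Fp_points p m)"

primrec iterated :: "nat \<Rightarrow> (nat \<Rightarrow> nat \<Rightarrow> int_mpoly) \<Rightarrow> nat \<Rightarrow> nat \<Rightarrow> int_mpoly" where
  "iterated p Fs 0 = Var"
| "iterated p Fs (Suc k) = (\<lambda>i. Fp_comp p (Fs (Suc k) i) (iterated p Fs k))"

definition add_char :: "nat \<Rightarrow> int \<Rightarrow> complex" where
  "add_char M z = exp (2 * complex_of_real pi * \<i> * of_int z / of_nat M)"

definition A_bound :: "nat \<Rightarrow> nat \<Rightarrow> nat \<Rightarrow> real" where
  "A_bound m N p =
     (if real N \<le> real p powr (1 / (real m + 1))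
      then real N * real p ^ (m + 1)
      else (real N)\<^sup>2 * real p powr (real m * (real m + 2) / (real m + 1)))"

end

theory Submission
  imports Defs "HOL-Number_Theory.Cong" "HOL-Computational_Algebra.Polynomial"
    "HOL-Analysis.Convex"
begin

text \<open>
  Opening the square leaves correlations between two times \<open>k < n\<close> of the orbit.  Because the
  systems are permutations, the point at time \<open>k\<close> may be taken as the new starting point, so that
  the correlation becomes a sum over all \<open>w\<close> of the additive character at
  \<open>\<Sum>j. a\<^sub>j (F\<^sub>j(w) - w\<^sub>j)\<close>, where \<open>F\<close> is a composition of \<open>d = n - k\<close> systems.

  Let \<open>h\<close> be the first index with \<open>a\<^sub>h \<noteq> 0\<close>.  The component \<open>F\<^sub>h\<close> is affine in \<open>w\<^sub>h\<close>, with a slope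
  depending on later coordinates, and the components after \<open>h\<close> do not contain \<open>w\<^sub>h\<close>.  Summation
  over \<open>w\<^sub>h\<close> thus annihilates everything but the points where the slope is \<open>1\<close>
  (\<open>norm_orbit_correlation_le\<close>), and the point is to show that these are few: at most a constant
  times \<open>d p\<^sup>m\<close> (\<open>card_slope_eq_1\<close>).

  This is done one variable at a time, without estimating degrees of multivariate iterates.  The
  slope is the product of the polynomials \<open>G\<^sub>h\<close> of the \<open>d\<close> systems evaluated along the orbit.  In
  the single variable \<open>w\<^sub>h\<^sub>+\<^sub>1\<close>, the orbit coordinate \<open>h + 1\<close> is affine, and its slope is never
  zero, since otherwise the composition would not be injective (\<open>slope_not_dvd\<close>); the later orbit
  coordinates are constant.  So each factor is a polynomial in \<open>w\<^sub>h\<^sub>+\<^sub>1\<close> of degree exactly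
  \<open>s\<^sub>h\<^sub>,\<^sub>h\<^sub>+\<^sub>1 > 0\<close>, unless one of the later orbit coordinates, which occur in its leading
  coefficient, is zero (\<open>slope_poly\<close>).  By bijectivity each such coordinate is zero at no more than
  \<open>p\<^sup>m\<close> points, so the exceptions at all times up to \<open>d\<close> are few; elsewhere Lagrange's bound for
  the number of roots applies.

  For \<open>N\<close> terms the diagonal contributes \<open>N p\<^sup>m\<^sup>+\<^sup>1\<close> and the rest a constant times \<open>N\<^sup>3 p\<^sup>m\<close>, which
  is of no larger order while \<open>N \<le> p\<^sup>1\<^sup>/\<^sup>(\<^sup>m\<^sup>+\<^sup>1\<^sup>)\<close>.  A longer sum is cut into blocks of about this
  length, each of which is again a sum over an orbit with a new starting point, and Cauchy's
  inequality gives the second case of the bound.  The factors \<open>add_char M (c n)\<close> are treated as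
  weights of modulus at most \<open>1\<close>, a class closed under truncation and shifts of the time.
\<close>

section \<open>Substitution into integer polynomials\<close>

text \<open>
  Substitution is a ring homomorphism, hence composing polynomials and then evaluating at a point
  is the same as iterating the polynomial maps.  Every question about the iterates is thereby
  moved from formal polynomials to maps on points.
\<close>

definition monomial_value :: "(nat \<Rightarrow> 'b::comm_ring_1) \<Rightarrow> (nat \<Rightarrow>\<^sub>0 nat) \<Rightarrow> 'b" where
  "monomial_value x t = (\<Prod>i\<in>Poly_Mapping.keys t. x i ^ Poly_Mapping.lookup t i)"

text \<open>
  Enlarging the set of variables allows two monomials to be compared factor by factor; likewise
  below for the sets of monomials of two polynomials.
\<close>

lemma monomial_value_superset:
  assumes "finite A" "Poly_Mapping.keys t \<subseteq> A"
  shows "monomial_value x t = (\<Prod>i\<in>A. x i ^ Poly_Mapping.lookup t i)"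
  unfolding monomial_value_def using assms
  by (intro prod.mono_neutral_left) (auto simp: in_keys_iff)

lemma monomial_value_add:
  "monomial_value x (t + u) = monomial_value x t * monomial_value x u"
proof -
  let ?A = "Poly_Mapping.keys t \<union> Poly_Mapping.keys u"
  have "monomial_value x (t + u) = (\<Prod>i\<in>?A. x i ^ Poly_Mapping.lookup (t + u) i)"
    by (rule monomial_value_superset) (simp_all add: Poly_Mapping.keys_add)
  also have "\<dots> = (\<Prod>i\<in>?A. x i ^ Poly_Mapping.lookup t i) * (\<Prod>i\<in>?A. x i ^ Poly_Mapping.lookup u i)"
    by (simp add: lookup_add power_add prod.distrib)
  also have "\<dots> = monomial_value x t * monomial_value x u"
    by (simp add: monomial_value_superset[of ?A])
  finally show ?thesis .
qed

lemma insertion_superset: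
  assumes "finite A" "Poly_Mapping.keys P \<subseteq> A"
  shows "insertion x P = (\<Sum>t\<in>A. of_int (Poly_Mapping.lookup P t) * monomial_value x t)"
  unfolding insertion_def monomial_value_def using assms
  by (intro sum.mono_neutral_left) (auto simp: in_keys_iff)

lemma insertion_0 [simp]: "insertion x 0 = 0"
  by (simp add: insertion_def)

lemma insertion_add [simp]: "insertion x (P + Q) = insertion x P + insertion x Q"
proof -
  let ?A = "Poly_Mapping.keys P \<union> Poly_Mapping.keys Q"
  have "insertion x (P + Q) = (\<Sum>t\<in>?A. of_int (Poly_Mapping.lookup (P + Q) t) * monomial_value x t)"
    by (rule insertion_superset) (simp_all add: Poly_Mapping.keys_add)
  also have "\<dots> = insertion x P + insertion x Q"
    by (simp add: insertion_superset[of ?A] lookup_add sum.distrib distrib_right)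
  finally show ?thesis .
qed

lemma insertion_sum [simp]: "insertion x (\<Sum>i\<in>A. f i) = (\<Sum>i\<in>A. insertion x (f i))"
  by (induction A rule: infinite_finite_induct) auto

lemma insertion_single [simp]:
  "insertion x (Poly_Mapping.single t c) = of_int c * monomial_value x t"
  by (simp add: insertion_superset[of "{t}"])

lemma sum_of_monomials:
  "P = (\<Sum>t\<in>Poly_Mapping.keys P. Poly_Mapping.single t (Poly_Mapping.lookup P t))"
  for P :: int_mpoly
  by (rule poly_mapping_eqI)
    (auto simp: lookup_sum lookup_single when_def in_keys_iff sum.delta)

lemma insertion_mult [simp]: "insertion x (P * Q) = insertion x P * insertion x Q"
proof -
  have "insertion x (P * Q) = insertion x
     ((\<Sum>t\<in>Poly_Mapping.keys P. Poly_Mapping.single t (Poly_Mapping.lookup P t)) *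
      (\<Sum>u\<in>Poly_Mapping.keys Q. Poly_Mapping.single u (Poly_Mapping.lookup Q u)))"
    by (simp flip: sum_of_monomials)
  also have "\<dots> = (\<Sum>t\<in>Poly_Mapping.keys P. of_int (Poly_Mapping.lookup P t) * monomial_value x t) *
      (\<Sum>u\<in>Poly_Mapping.keys Q. of_int (Poly_Mapping.lookup Q u) * monomial_value x u)"
    by (simp add: sum_product mult_single monomial_value_add mult_ac)
  also have "\<dots> = insertion x P * insertion x Q"
    by (simp add: insertion_superset[of "Poly_Mapping.keys P"] insertion_superset[of "Poly_Mapping.keys Q"])
  finally show ?thesis .
qed

lemma insertion_1 [simp]: "insertion x 1 = 1"
  using insertion_single[of x 0 1] by (simp add: monomial_value_def)

lemma insertion_prod [simp]: "insertion x (\<Prod>i\<in>A. f i) = (\<Prod>i\<in>A. insertion x (f i))"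
  by (induction A rule: infinite_finite_induct) auto

lemma insertion_power [simp]: "insertion x (P ^ n) = insertion x P ^ n"
  by (induction n) auto

lemma insertion_of_int [simp]: "insertion x (of_int c) = of_int c"
  using insertion_single[of x 0 c] by (simp add: monomial_value_def flip: single_of_int)

lemma insertion_Const [simp]: "insertion x (Const c) = of_int c"
  by (simp add: Const_def monomial_value_def)

lemma insertion_Var [simp]: "insertion x (Var i) = x i"
  by (simp add: Var_def monomial_value_def)

lemma insertion_insertion:
  "insertion x (insertion Q P) = insertion (\<lambda>i. insertion x (Q i)) P"
  by (simp add: insertion_def[of _ P])

lemma insertion_cong:
  assumes "\<And>t i. t \<in> Poly_Mapping.keys P \<Longrightarrow> i \<in> Poly_Mapping.keys t \<Longrightarrow> x i = y i"
  shows "insertion x P = insertion y P"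
  unfolding insertion_def using assms by (intro sum.cong refl arg_cong2[of _ _ _ _ "(*)"] prod.cong) auto

lemma insertion_reduce: "[insertion x (reduce p P) = insertion x P] (mod int p)"
  for x :: "nat \<Rightarrow> int"
proof -
  have look: "Poly_Mapping.lookup (reduce p P) t = Poly_Mapping.lookup P t mod int p" for t
    by (simp add: reduce_def Poly_Mapping.map.rep_eq when_def)
  have "Poly_Mapping.keys (reduce p P) \<subseteq> Poly_Mapping.keys P"
    by (auto simp: in_keys_iff look)
  then show ?thesis
    unfolding insertion_superset[OF finite_keys \<open>_ \<subseteq> _\<close>] insertion_superset[where P = P, OF finite_keys subset_refl]
    by (intro cong_sum cong_mult cong_refl) (simp add: look)
qed

lemma insertion_cong_mod:
  fixes x y :: "nat \<Rightarrow> int"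
  assumes "\<And>i. [x i = y i] (mod k)"
  shows "[insertion x P = insertion y P] (mod k)"
  unfolding insertion_def using assms
  by (intro cong_sum cong_mult cong_prod cong_pow cong_refl) auto

section \<open>Roots of integer polynomials modulo a prime\<close>

lemma finite_Fp [simp]: "finite (Fp p)"
  by (simp add: Fp_def)

lemma card_Fp [simp]: "card (Fp p) = p"
  by (simp add: Fp_def)

lemma poly_cong:
  fixes x y :: int
  assumes "[x = y] (mod k)"
  shows "[poly q x = poly q y] (mod k)"
  by (induction q) (auto intro!: cong_add cong_mult assms)

text \<open>
  Lagrange's bound.  A root \<open>r\<close> modulo \<open>p\<close> is divided out by the integer polynomial identity
  \<open>q = (X - r) u + q(r)\<close>; the quotient keeps the leading coefficient, so the hypothesis on it
  survives the induction on the degree.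
\<close>

lemma card_roots_mod_prime_le:
  fixes q :: "int poly"
  assumes p: "prime p" and "\<not> int p dvd lead_coeff q"
  shows "card {x \<in> Fp p. int p dvd poly q x} \<le> degree q"
  using assms(2)
proof (induction "degree q" arbitrary: q)
  case 0
  then obtain a where "q = [:a:]"
    by (metis degree_eq_zeroE)
  with 0 show ?case by simp
next
  case (Suc d)
  let ?R = "\<lambda>q. {x \<in> Fp p. int p dvd poly q x}"
  show ?case
  proof (cases "?R q = {}")
    case False
    then obtain r where r: "r \<in> Fp p" "int p dvd poly q r" by auto
    define u where "u = synthetic_div q r"
    have q: "q = [:- r, 1:] * u + [:poly q r:]"
      by (simp add: u_def synthetic_div_correct' del: mult_pCons_left)
    have du: "degree u = d"
      using Suc.hyps(2) by (simp add: u_def degree_synthetic_div)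
    have "coeff q (Suc d) = coeff u d"
      using du by (subst q) (simp add: coeff_eq_0)
    then have "lead_coeff q = lead_coeff u"
      using Suc.hyps(2) du by simp
    then have "card (?R u) \<le> d"
      using Suc.hyps(1)[of u] Suc.prems du by simp
    moreover have "?R q \<subseteq> insert r (?R u)"
    proof
      fix x assume x: "x \<in> ?R q"
      have "poly q x = (x - r) * poly u x + poly q r"
        by (subst q) (simp add: algebra_simps)
      then have "int p dvd (x - r) * poly u x"
        using x r(2) by (simp add: dvd_add_left_iff)
      then have "int p dvd x - r \<or> int p dvd poly u x"
        using p by (simp add: prime_dvd_mult_iff)
      moreover have "x = r" if "int p dvd x - r"
      proof -
        have "[x = r] (mod int p)" using that by (simp add: cong_iff_dvd_diff)
        then show ?thesis
          using x r(1) by (auto simp: Fp_def cong_def)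
      qed
      ultimately show "x \<in> insert r (?R u)" using x by auto
    qed
    moreover have "card (?R q) \<le> card (insert r (?R u))"
      using calculation(2) by (intro card_mono) auto
    ultimately have "card (?R q) \<le> Suc d"
      using card_insert_le_m1[of "Suc d" "?R u" r] by simp
    then show ?thesis using Suc.hyps(2) by simp
  next
    case True
    show ?thesis unfolding True by simp
  qed
qed

section \<open>Additive characters\<close>

lemma add_char_cis: "add_char M z = cis (2 * pi * of_int z / of_nat M)"
  by (simp add: add_char_def cis_conv_exp algebra_simps)

lemma norm_add_char [simp]: "cmod (add_char M z) = 1"
  by (simp add: add_char_cis)

lemma add_char_add: "add_char M (x + y) = add_char M x * add_char M y"
  by (simp add: add_char_cis cis_mult add_divide_distrib distrib_left)

lemma add_char_0 [simp]: "add_char M 0 = 1"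
  by (simp add: add_char_def)

lemma cnj_add_char: "cnj (add_char M x) = add_char M (- x)"
  by (simp add: add_char_cis cis_cnj)

lemma add_char_eq_1_iff:
  assumes "M > 0"
  shows "add_char M z = 1 \<longleftrightarrow> int M dvd z"
proof
  assume "add_char M z = 1"
  then have "cos (2 * pi * of_int z / of_nat M) = 1"
    by (metis add_char_cis cis.sel(1) one_complex.sel(1))
  then obtain n :: int where "2 * pi * of_int z / of_nat M = of_int n * 2 * pi"
    by (auto simp: cos_one_2pi_int)
  then have "real_of_int z = real_of_int n * real M"
    using assms by (simp add: field_simps)
  then have "z = n * int M"
    by (metis of_int_eq_iff of_int_mult of_int_of_nat_eq)
  then show "int M dvd z" by simp
next
  assume "int M dvd z"
  then obtain k where "z = int M * k" by (auto elim: dvdE)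
  then have "2 * pi * of_int z / of_nat M = 2 * pi * of_int k"
    using assms by simp
  then show "add_char M z = 1"
    by (simp add: add_char_cis del: of_int_mult)
qed

lemma add_char_cong:
  assumes "M > 0" "[x = y] (mod int M)"
  shows "add_char M x = add_char M y"
proof -
  have "add_char M (x - y) = 1"
    using assms by (simp add: add_char_eq_1_iff cong_iff_dvd_diff)
  then show ?thesis
    using add_char_add[of M "x - y" y] by simp
qed

lemma add_char_of_nat_mult: "add_char M (int n * z) = add_char M z ^ n"
  by (induction n) (simp_all add: add_char_add distrib_right)

lemma sum_add_char:
  assumes "p > 0"
  shows "(\<Sum>x\<in>Fp p. add_char p (x * b)) = (if int p dvd b then of_nat p else 0)"
proof -
  have "Fp p = int ` {..<p}"
    by (simp add: Fp_def image_int_atLeastLessThan lessThan_atLeast0)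
  then have "(\<Sum>x\<in>Fp p. add_char p (x * b)) = (\<Sum>n<p. add_char p (int n * b))"
    by (simp add: sum.reindex)
  also have "\<dots> = (\<Sum>n<p. add_char p b ^ n)"
    by (simp add: add_char_of_nat_mult)
  also have "\<dots> = (if int p dvd b then of_nat p else 0)"
  proof (cases "int p dvd b")
    case True
    then have "add_char p b = 1" using assms by (simp add: add_char_eq_1_iff)
    then show ?thesis using True by simp
  next
    case False
    then have "add_char p b \<noteq> 1" using assms by (simp add: add_char_eq_1_iff)
    moreover have "add_char p b ^ p = 1"
      using assms by (simp add: add_char_eq_1_iff flip: add_char_of_nat_mult)
    ultimately show ?thesis using False by (simp add: geometric_sum)
  qed
  finally show ?thesis .
qed

section \<open>Averaging over one coordinate\<close>

lemma finite_Fp_points [simp]: "finite (Fp_points p m)"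
  by (simp add: Fp_points_def finite_PiE)

lemma card_Fp_points: "card (Fp_points p m) = p ^ (m + 1)"
  by (simp add: Fp_points_def card_PiE)

lemma Fp_points_upd:
  assumes "w \<in> Fp_points p m" "i \<le> m" "x \<in> Fp p"
  shows "w(i := x) \<in> Fp_points p m"
  using assms by (auto simp: Fp_points_def PiE_iff extensional_def)

lemma Fp_points_Fp:
  assumes "w \<in> Fp_points p m" "i \<le> m"
  shows "w i \<in> Fp p"
  using assms by (auto simp: Fp_points_def)

lemma Fp_points_eqI:
  assumes "w \<in> Fp_points p m" "w' \<in> Fp_points p m" "\<And>i. i \<le> m \<Longrightarrow> w i = w' i"
  shows "w = w'"
  using assms unfolding Fp_points_def by (intro PiE_ext) auto

lemma Fp_cong_eq:
  assumes "x \<in> Fp p" "y \<in> Fp p" "[x = y] (mod int p)"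
  shows "x = y"
  using assms by (auto simp: Fp_def cong_def)

lemma not_dvd_of_Fp:
  assumes "x \<in> Fp p" "x \<noteq> 0"
  shows "\<not> int p dvd x"
  using assms by (auto simp: Fp_def dest: zdvd_not_zless[rotated])

text \<open>
  As \<open>w\<close> runs over all points, each line in direction \<open>i\<close> occurs \<open>p\<close> times, once for each of
  its points.
\<close>

lemma sum_over_fibres:
  fixes f :: "(nat \<Rightarrow> int) \<Rightarrow> 'a::comm_semiring_1"
  assumes i: "i \<le> m"
  shows "(\<Sum>w\<in>Fp_points p m. \<Sum>x\<in>Fp p. f (w(i := x))) = of_nat p * (\<Sum>w\<in>Fp_points p m. f w)"
proof -
  let ?E = "Fp_points p m \<times> Fp p"
  \<comment> \<open>Exchanging \<open>w i\<close> with \<open>x\<close> is an involution of the set of pairs \<open>(w, x)\<close>.\<close>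
  have "(\<Sum>(w, x)\<in>?E. f (w(i := x))) = (\<Sum>(w, x)\<in>?E. f w)"
    by (rule sum.reindex_bij_witness[where i = "\<lambda>(w, x). (w(i := x), w i)"
          and j = "\<lambda>(w, x). (w(i := x), w i)"])
      (use i in \<open>auto simp: Fp_points_upd Fp_points_Fp\<close>)
  then show ?thesis
    by (simp add: sum.cartesian_product[symmetric] sum_distrib_left)
qed

text \<open>
  A set with few points on every line in one coordinate direction is small.  This serves both for
  coordinate hyperplanes (\<open>d = 1\<close>) and for zero sets of polynomials (\<open>d\<close> the degree).
\<close>

lemma card_le_of_fibres:
  assumes i: "i \<le> m" and p: "p > 0" and A: "A \<subseteq> Fp_points p m"
    and fib: "\<And>w. w \<in> Fp_points p m \<Longrightarrow> card {x \<in> Fp p. w(i := x) \<in> A} \<le> d"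
  shows "card A \<le> d * p ^ m"
proof -
  let ?f = "\<lambda>w. of_bool (w \<in> A) :: nat"
  have "p * card A = p * (\<Sum>w\<in>Fp_points p m. ?f w)"
    using A by (simp add: Int_absorb1 Int_def[symmetric] flip: sum.inter_filter)
  also have "\<dots> = (\<Sum>w\<in>Fp_points p m. \<Sum>x\<in>Fp p. ?f (w(i := x)))"
    using sum_over_fibres[OF i, of ?f p] by simp
  also have "\<dots> = (\<Sum>w\<in>Fp_points p m. card {x \<in> Fp p. w(i := x) \<in> A})"
    by (simp add: Int_def)
  also have "\<dots> \<le> (\<Sum>w\<in>Fp_points p m. d)"
    by (rule sum_mono) (rule fib)
  also have "\<dots> = p * (d * p ^ m)"
    by (simp add: card_Fp_points)
  finally show ?thesis using p by simp
qed

section \<open>Orbits of triangular permutations\<close>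

text \<open>
  What is kept of the shape of a system, in terms of values only: the \<open>i\<close>-th component is affine
  in the \<open>i\<close>-th coordinate, with slope \<open>G i\<close> and intercept \<open>H i\<close> depending on the later
  coordinates.  Since in \<open>G i\<close> the leading monomial has, in the variable \<open>i + 1\<close>, a degree strictly
  above that of every other term, \<open>G i\<close> restricted to a line in direction \<open>i + 1\<close> is a polynomial
  of degree exactly \<open>s i\<close> as soon as the remaining variables of the leading monomial are nonzero.
  The functions \<open>G i\<close> and \<open>H i\<close> have integer values that matter only modulo \<open>p\<close>.
\<close>

definition triangular_map ::
  "nat \<Rightarrow> nat \<Rightarrow> (nat \<Rightarrow> nat) \<Rightarrow> ((nat \<Rightarrow> int) \<Rightarrow> nat \<Rightarrow> int) \<Rightarrow>
   (nat \<Rightarrow> (nat \<Rightarrow> int) \<Rightarrow> int) \<Rightarrow> (nat \<Rightarrow> (nat \<Rightarrow> int) \<Rightarrow> int) \<Rightarrow> bool" where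
  "triangular_map p m s T G H \<longleftrightarrow>
     (\<forall>w\<in>Fp_points p m. \<forall>i\<le>m. [T w i = w i * G i w + H i w] (mod int p)) \<and>
     (\<forall>w\<in>Fp_points p m. \<forall>w'\<in>Fp_points p m. \<forall>i\<le>m. (\<forall>j\<in>{i<..m}. w j = w' j) \<longrightarrow>
        G i w = G i w' \<and> H i w = H i w') \<and>
     (\<forall>w\<in>Fp_points p m. \<forall>i<m. (\<forall>j\<in>{i + 1<..m}. w j \<noteq> 0) \<longrightarrow>
        (\<exists>q. degree q = s i \<and> \<not> int p dvd lead_coeff q \<and>
             (\<forall>x\<in>Fp p. [G i (w(i + 1 := x)) = poly q x] (mod int p))))"

primrec orbit :: "(nat \<Rightarrow> 'a \<Rightarrow> 'a) \<Rightarrow> nat \<Rightarrow> 'a \<Rightarrow> 'a" where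
  "orbit T 0 = id"
| "orbit T (Suc n) = T n \<circ> orbit T n"

lemma orbit_add: "orbit T (n + k) w = orbit (\<lambda>l. T (n + l)) k (orbit T n w)"
  by (induction k) auto

text \<open>
  The assumptions are invariant under dropping an initial segment of the sequence, so every bound
  obtained here also holds for the part of an orbit that follows a given time.
\<close>

locale triangular_permutations =
  fixes p m :: nat and s :: "nat \<Rightarrow> nat"
    and T :: "nat \<Rightarrow> (nat \<Rightarrow> int) \<Rightarrow> nat \<Rightarrow> int"
    and G H :: "nat \<Rightarrow> nat \<Rightarrow> (nat \<Rightarrow> int) \<Rightarrow> int"
  assumes prime_p: "prime p"
    and s_pos: "\<And>i. i < m \<Longrightarrow> s i > 0"
    and bij: "\<And>k. bij_betw (T k) (Fp_points p m) (Fp_points p m)"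
    and tri: "\<And>k. triangular_map p m s (T k) (G k) (H k)"
begin

lemma p_pos [simp]: "p > 0"
  using prime_p by (simp add: prime_gt_0_nat)

lemma p_gt_1 [simp]: "p > 1"
  using prime_gt_1_nat[OF prime_p] .

lemma prime_int: "prime (int p)"
  using prime_p by simp

lemma shifted: "triangular_permutations p m s (\<lambda>l. T (n + l)) (\<lambda>l. G (n + l)) (\<lambda>l. H (n + l))"
  by unfold_locales (simp_all add: prime_p s_pos bij tri)

lemma bij_orbit: "bij_betw (orbit T n) (Fp_points p m) (Fp_points p m)"
proof (induction n)
  case (Suc n)
  then show ?case unfolding orbit.simps by (rule bij_betw_trans[OF _ bij])
qed (simp add: bij_betw_def)

lemma orbit_points: "w \<in> Fp_points p m \<Longrightarrow> orbit T n w \<in> Fp_points p m"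
  using bij_betw_apply[OF bij_orbit] .

lemma T_cong:
  assumes "w \<in> Fp_points p m" "i \<le> m"
  shows "[T k w i = w i * G k i w + H k i w] (mod int p)"
  using tri[of k] assms unfolding triangular_map_def by blast

lemma G_cong:
  assumes "w \<in> Fp_points p m" "w' \<in> Fp_points p m" "i \<le> m" "\<And>j. j \<in> {i<..m} \<Longrightarrow> w j = w' j"
  shows "G k i w = G k i w'" "H k i w = H k i w'"
proof -
  have "\<forall>j\<in>{i<..m}. w j = w' j" using assms(4) by blast
  then have "G k i w = G k i w' \<and> H k i w = H k i w'"
    using tri[of k] assms(1-3) unfolding triangular_map_def by blast
  then show "G k i w = G k i w'" "H k i w = H k i w'" by blast+
qed

lemma G_poly:
  assumes "w \<in> Fp_points p m" "i < m" "\<And>j. j \<in> {i + 1<..m} \<Longrightarrow> w j \<noteq> 0"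
  obtains q where "degree q = s i" "\<not> int p dvd lead_coeff q"
    "\<And>x. x \<in> Fp p \<Longrightarrow> [G k i (w(i + 1 := x)) = poly q x] (mod int p)"
proof -
  have "\<forall>j\<in>{i + 1<..m}. w j \<noteq> 0" using assms(3) by blast
  then have "\<exists>q. degree q = s i \<and> \<not> int p dvd lead_coeff q \<and>
      (\<forall>x\<in>Fp p. [G k i (w(i + 1 := x)) = poly q x] (mod int p))"
    using tri[of k] assms(1,2) unfolding triangular_map_def by blast
  then show thesis using that by blast
qed

text \<open>
  Composition of affine maps in the \<open>i\<close>-th coordinate: slopes multiply along the orbit.
\<close>

definition slope :: "nat \<Rightarrow> nat \<Rightarrow> (nat \<Rightarrow> int) \<Rightarrow> int" where
  "slope n i w = (\<Prod>l<n. G l i (orbit T l w))"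

primrec intercept :: "nat \<Rightarrow> nat \<Rightarrow> (nat \<Rightarrow> int) \<Rightarrow> int" where
  "intercept 0 i w = 0"
| "intercept (Suc n) i w = intercept n i w * G n i (orbit T n w) + H n i (orbit T n w)"

lemma orbit_linear:
  assumes "w \<in> Fp_points p m" "i \<le> m"
  shows "[orbit T n w i = w i * slope n i w + intercept n i w] (mod int p)"
proof (induction n)
  case 0
  then show ?case by (simp add: slope_def)
next
  case (Suc n)
  let ?v = "orbit T n w"
  have "[orbit T (Suc n) w i = ?v i * G n i ?v + H n i ?v] (mod int p)"
    unfolding orbit.simps comp_def by (intro T_cong orbit_points assms)
  also have "[?v i * G n i ?v + H n i ?v =
      (w i * slope n i w + intercept n i w) * G n i ?v + H n i ?v] (mod int p)"
    by (intro cong_add cong_mult Suc.IH cong_refl)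
  also have "(w i * slope n i w + intercept n i w) * G n i ?v + H n i ?v =
      w i * slope (Suc n) i w + intercept (Suc n) i w"
    by (simp add: slope_def algebra_simps)
  finally show ?case .
qed

lemma orbit_depends:
  assumes "w \<in> Fp_points p m" "w' \<in> Fp_points p m" "i \<le> m" "\<And>j. j \<in> {i..m} \<Longrightarrow> w j = w' j"
  shows "orbit T n w i = orbit T n w' i"
  using assms(3,4)
proof (induction n arbitrary: i)
  case (Suc n)
  let ?v = "orbit T n w" and ?v' = "orbit T n w'"
  note points = orbit_points[OF assms(1), of n] orbit_points[OF assms(2), of n]
  have eq: "?v j = ?v' j" if "j \<in> {i..m}" for j
  proof (rule Suc.IH)
    show "j \<le> m" using that by simp
    show "w j' = w' j'" if "j' \<in> {j..m}" for j'
      using \<open>j \<in> {i..m}\<close> that by (intro Suc.prems(2)) simp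
  qed
  have GH: "G n i ?v = G n i ?v'" "H n i ?v = H n i ?v'"
    using G_cong[OF points Suc.prems(1), of n] eq by simp_all
  have "[T n ?v i = ?v i * G n i ?v + H n i ?v] (mod int p)"
    by (rule T_cong[OF points(1) Suc.prems(1)])
  also have "?v i * G n i ?v + H n i ?v = ?v' i * G n i ?v' + H n i ?v'"
    unfolding GH using eq[of i] Suc.prems(1) by simp
  also have "[?v' i * G n i ?v' + H n i ?v' = T n ?v' i] (mod int p)"
    by (rule cong_sym[OF T_cong[OF points(2) Suc.prems(1)]])
  finally have "T n ?v i = T n ?v' i"
    by (intro Fp_cong_eq[OF Fp_points_Fp[OF bij_betw_apply[OF bij] Suc.prems(1)]
          Fp_points_Fp[OF bij_betw_apply[OF bij] Suc.prems(1)]] points)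
  then show ?case by simp
qed simp

lemma slope_depends:
  assumes "w \<in> Fp_points p m" "w' \<in> Fp_points p m" "i \<le> m" "\<And>j. j \<in> {i<..m} \<Longrightarrow> w j = w' j"
  shows "slope n i w = slope n i w'" "intercept n i w = intercept n i w'"
proof -
  have eq: "G l i (orbit T l w) = G l i (orbit T l w')" "H l i (orbit T l w) = H l i (orbit T l w')" for l
  proof -
    have *: "orbit T l w j = orbit T l w' j" if "j \<in> {i<..m}" for j
      using that assms by (intro orbit_depends) auto
    show "G l i (orbit T l w) = G l i (orbit T l w')" "H l i (orbit T l w) = H l i (orbit T l w')"
      using G_cong[OF orbit_points[OF assms(1)] orbit_points[OF assms(2)] assms(3) *] by auto
  qed
  show "slope n i w = slope n i w'"
    by (simp add: slope_def eq)
  show "intercept n i w = intercept n i w'"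
    by (induction n) (simp_all add: eq)
qed

text \<open>
  A permutation cannot have a vanishing slope.  If the slope at \<open>w\<close> were zero, the
  \<open>p ^ (i + 1)\<close> points that agree with \<open>w\<close> after position \<open>i\<close> would all be mapped to points
  that agree with the image of \<open>w\<close> from position \<open>i\<close> on, and there are only \<open>p ^ i\<close> of these.
\<close>

lemma slope_not_dvd:
  assumes w: "w \<in> Fp_points p m" and i: "i \<le> m"
  shows "\<not> int p dvd slope n i w"
proof
  assume dvd: "int p dvd slope n i w"
  \<comment> \<open>The points whose first \<open>k\<close> coordinates are free and which agree with \<open>v\<close> in the others.\<close>
  define E :: "nat \<Rightarrow> (nat \<Rightarrow> int) \<Rightarrow> (nat \<Rightarrow> int) set"
    where "E k v = PiE {..m} (\<lambda>j. if j < k then Fp p else {v j})" for k v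
  have card_E: "card (E k v) = p ^ k" if "k \<le> m + 1" for k v
  proof -
    have "card (E k v) = (\<Prod>j\<le>m. if j < k then p else 1)"
      by (auto simp: E_def card_PiE intro!: prod.cong)
    also have "\<dots> = (\<Prod>j\<in>{..m} \<inter> {j. j < k}. p)"
      by (subst prod.If_cases) (simp_all only: finite_atMost prod.neutral_const mult_1_right)
    also have "{..m} \<inter> {j. j < k} = {..<k}" using that by auto
    finally show ?thesis by simp
  qed
  have E_eq: "E k v = {u \<in> Fp_points p m. \<forall>j\<in>{k..m}. u j = v j}" if "v \<in> Fp_points p m" for k v
  proof (rule Set.set_eqI)
    fix u
    show "u \<in> E k v \<longleftrightarrow> u \<in> {u \<in> Fp_points p m. \<forall>j\<in>{k..m}. u j = v j}"
      using that by (auto simp: E_def Fp_points_def PiE_iff not_less split: if_splits)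
        (metis atMost_iff not_le)
  qed
  have E_points: "E k v \<subseteq> Fp_points p m" if "v \<in> Fp_points p m" for k v
    unfolding E_eq[OF that] by blast
  let ?v = "orbit T n w"
  have "orbit T n ` E (i + 1) w \<subseteq> E i ?v"
  proof
    fix y assume "y \<in> orbit T n ` E (i + 1) w"
    then obtain u where u: "u \<in> E (i + 1) w" "y = orbit T n u" by auto
    have up: "u \<in> Fp_points p m" using u(1) unfolding E_eq[OF w] by blast
    have uw: "u j = w j" if "j \<in> {i<..m}" for j
      using u(1) that unfolding E_eq[OF w] by (simp add: Suc_le_eq)
    have "y j = ?v j" if "j \<in> {i<..m}" for j
      unfolding u(2)
    proof (rule orbit_depends[OF up w])
      show "j \<le> m" using that by simp
      show "u j' = w j'" if "j' \<in> {j..m}" for j'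
        using \<open>j \<in> {i<..m}\<close> that by (intro uw) simp
    qed
    moreover have "y i = ?v i"
    proof -
      have "slope n i u = slope n i w" "intercept n i u = intercept n i w"
        by (rule slope_depends[OF up w i uw]; assumption)+
      moreover have "[u i * slope n i w + intercept n i w = w i * slope n i w + intercept n i w] (mod int p)"
        using dvd by (intro cong_add cong_refl) (simp add: cong_iff_dvd_diff flip: left_diff_distrib)
      ultimately have "[y i = ?v i] (mod int p)"
        unfolding u(2) using orbit_linear[OF up i, of n] orbit_linear[OF w i, of n]
        by (metis cong_sym cong_trans)
      then show ?thesis
        unfolding u(2) using i up w
        by (intro Fp_cong_eq[OF Fp_points_Fp[OF orbit_points] Fp_points_Fp[OF orbit_points]])
    qed
    ultimately have "y j = ?v j" if "j \<in> {i..m}" for j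
      using that by (cases "j = i") simp_all
    moreover have "y \<in> Fp_points p m" unfolding u(2) by (rule orbit_points[OF up])
    ultimately show "y \<in> E i ?v"
      unfolding E_eq[OF orbit_points[OF w]] by blast
  qed
  then have "card (orbit T n ` E (i + 1) w) \<le> card (E i ?v)"
    by (rule card_mono[rotated]) (simp add: E_def finite_PiE)
  moreover have "card (orbit T n ` E (i + 1) w) = card (E (i + 1) w)"
    by (rule card_image) (rule inj_on_subset[OF bij_betw_imp_inj_on[OF bij_orbit] E_points[OF w]])
  ultimately have "p ^ (i + 1) \<le> p ^ i" using i by (simp add: card_E)
  then show False using p_gt_1 by (simp add: power_increasing_iff)
qed

lemma card_orbit_eq_0:
  assumes j: "j \<le> m"
  shows "card {w \<in> Fp_points p m. orbit T n w j = 0} \<le> p ^ m"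
proof -
  let ?Z = "{w \<in> Fp_points p m. w j = 0}"
  have "orbit T n ` {w \<in> Fp_points p m. orbit T n w j = 0} \<subseteq> ?Z"
    using orbit_points by auto
  then have "card (orbit T n ` {w \<in> Fp_points p m. orbit T n w j = 0}) \<le> card ?Z"
    by (rule card_mono[rotated]) simp
  moreover have "inj_on (orbit T n) {w \<in> Fp_points p m. orbit T n w j = 0}"
    by (rule inj_on_subset[OF bij_betw_imp_inj_on[OF bij_orbit]]) blast
  ultimately have "card {w \<in> Fp_points p m. orbit T n w j = 0} \<le> card ?Z"
    by (simp only: card_image)
  also have "\<dots> \<le> 1 * p ^ m"
  proof (rule card_le_of_fibres[OF j])
    fix w
    have "{x \<in> Fp p. w(j := x) \<in> ?Z} \<subseteq> {0}" by auto
    then have "card {x \<in> Fp p. w(j := x) \<in> ?Z} \<le> card {0::int}"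
      by (rule card_mono[rotated]) simp
    then show "card {x \<in> Fp p. w(j := x) \<in> ?Z} \<le> 1" by simp
  qed auto
  finally show ?thesis by simp
qed

text \<open>
  Along a line in direction \<open>i + 1\<close>, coordinate \<open>i + 1\<close> of the orbit is affine with a slope that
  is a unit, and the coordinates after it are constant.  Each factor \<open>G l i\<close> of the slope is
  therefore a polynomial of degree exactly \<open>s i\<close>, composed with an invertible affine substitution,
  as long as those constant coordinates are nonzero.  Degrees add up in the product.
\<close>

lemma slope_poly:
  assumes w: "w \<in> Fp_points p m" and i: "i < m"
    and good: "\<And>l j. l < n \<Longrightarrow> j \<in> {i + 1<..m} \<Longrightarrow> orbit T l w j \<noteq> 0"
  shows "\<exists>q. degree q = n * s i \<and> \<not> int p dvd lead_coeff q \<and>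
     (\<forall>x\<in>Fp p. [slope n i (w(i + 1 := x)) = poly q x] (mod int p))"
  using good
proof (induction n)
  case 0
  show ?case
    by (rule exI[of _ 1]) (use p_gt_1 in \<open>auto simp: slope_def zdvd1_eq\<close>)
next
  case (Suc n)
  obtain q where q: "degree q = n * s i" "\<not> int p dvd lead_coeff q"
    "\<And>x. x \<in> Fp p \<Longrightarrow> [slope n i (w(i + 1 := x)) = poly q x] (mod int p)"
    using Suc.IH[OF Suc.prems[OF less_SucI]] by blast
  let ?v = "orbit T n w"
  obtain r where r: "degree r = s i" "\<not> int p dvd lead_coeff r"
    "\<And>x. x \<in> Fp p \<Longrightarrow> [G n i (?v(i + 1 := x)) = poly r x] (mod int p)"
    using G_poly[OF orbit_points[OF w] i Suc.prems[OF lessI]] by blast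
  define A where "A = slope n (i + 1) w"
  define B where "B = intercept n (i + 1) w"
  have A: "\<not> int p dvd A" using slope_not_dvd w i by (simp add: A_def)
  then have "A \<noteq> 0" by auto
  \<comment> \<open>Coordinate \<open>i + 1\<close> of the orbit is \<open>A x + B\<close> at the point with coordinate \<open>x\<close>.\<close>
  define t where "t = pcompose r [:B, A:]"
  have degree_t: "degree t = s i"
    using r(1) \<open>A \<noteq> 0\<close> by (simp add: t_def degree_pcompose)
  have "lead_coeff t = lead_coeff r * A ^ s i"
    unfolding t_def using r(1) \<open>A \<noteq> 0\<close> by (subst lead_coeff_comp) simp_all
  then have t: "degree t = s i" "\<not> int p dvd lead_coeff t"
    using r(2) A prime_dvd_power[OF prime_int, of A "s i"] degree_t
    by (simp_all only: prime_dvd_mult_iff[OF prime_int]) blast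
  have "q \<noteq> 0" "t \<noteq> 0" using q(2) t(2) by auto
  show ?case
  proof (intro exI[of _ "q * t"] conjI ballI)
    show "degree (q * t) = Suc n * s i"
      using \<open>q \<noteq> 0\<close> \<open>t \<noteq> 0\<close> q(1) t(1) by (simp add: degree_mult_eq)
    show "\<not> int p dvd lead_coeff (q * t)"
      using q(2) t(2) by (simp add: lead_coeff_mult prime_dvd_mult_iff[OF prime_int])
    fix x assume x: "x \<in> Fp p"
    let ?w = "w(i + 1 := x)"
    let ?u = "orbit T n ?w"
    have wp: "?w \<in> Fp_points p m" using Fp_points_upd w i x by simp
    have up: "?u \<in> Fp_points p m" using orbit_points wp .
    have ui: "?u (i + 1) \<in> Fp p" using Fp_points_Fp[OF up] i by simp
    have "slope n (i + 1) ?w = A" "intercept n (i + 1) ?w = B"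
      unfolding A_def B_def using slope_depends[OF wp w, of "i + 1"] i by auto
    then have lin: "[?u (i + 1) = x * A + B] (mod int p)"
      using orbit_linear[OF wp, of "i + 1" n] i by simp
    have G_eq: "G n i ?u = G n i (?v(i + 1 := ?u (i + 1)))"
    proof (rule G_cong(1))
      show "?v(i + 1 := ?u (i + 1)) \<in> Fp_points p m"
        using Fp_points_upd orbit_points w i ui by simp
      show "?u j = (?v(i + 1 := ?u (i + 1))) j" if "j \<in> {i<..m}" for j
        using that wp w by (cases "j = i + 1") (auto intro: orbit_depends)
    qed (use up i in auto)
    have "[G n i ?u = poly r (?u (i + 1))] (mod int p)"
      unfolding G_eq by (rule r(3)[OF ui])
    also have "[poly r (?u (i + 1)) = poly r (x * A + B)] (mod int p)"
      by (rule poly_cong[OF lin])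
    also have "poly r (x * A + B) = poly t x"
      by (simp add: t_def poly_pcompose add.commute)
    finally have "[G n i ?u = poly t x] (mod int p)" .
    with q(3)[OF x] show "[slope (Suc n) i ?w = poly (q * t) x] (mod int p)"
      by (simp add: slope_def cong_mult)
  qed
qed

text \<open>
  The points excluded in the previous lemma lie on the preimages of at most \<open>m n\<close> coordinate
  hyperplanes under bijections, which accounts for the term \<open>m\<close>.  On every other line the slope
  minus \<open>1\<close> is a polynomial of degree \<open>n s i > 0\<close> and has at most that many roots.
\<close>

lemma card_slope_eq_1:
  assumes i: "i < m" and n: "n > 0"
  shows "card {w \<in> Fp_points p m. [slope n i w = 1] (mod int p)} \<le> (s i + m) * n * p ^ m"
proof -
  define bad where "bad = (\<Union>(l, j)\<in>{..<n} \<times> {i + 1<..m}. {w \<in> Fp_points p m. orbit T l w j = 0})"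
  define A where "A = {w \<in> Fp_points p m. [slope n i w = 1] (mod int p)} - bad"
  have "card bad \<le> (\<Sum>(l, j)\<in>{..<n} \<times> {i + 1<..m}. card {w \<in> Fp_points p m. orbit T l w j = 0})"
    unfolding bad_def using card_UN_le[of "{..<n} \<times> {i + 1<..m}"] by (simp add: case_prod_unfold)
  also have "\<dots> \<le> (\<Sum>(l, j)\<in>{..<n} \<times> {i + 1<..m}. p ^ m)"
    by (rule sum_mono) (auto intro: card_orbit_eq_0)
  also have "\<dots> = n * (m - (i + 1)) * p ^ m"
    by (simp add: case_prod_unfold)
  also have "\<dots> \<le> m * n * p ^ m" by simp
  finally have bad: "card bad \<le> m * n * p ^ m" .
  have "card A \<le> (n * s i) * p ^ m"
  proof (rule card_le_of_fibres[where i = "i + 1"])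
    fix w assume w: "w \<in> Fp_points p m"
    \<comment> \<open>Whether a point is bad does not depend on its coordinate \<open>i + 1\<close>: one good point on the line
      makes the whole line good.\<close>
    show "card {x \<in> Fp p. w(i + 1 := x) \<in> A} \<le> n * s i"
    proof (cases "{x \<in> Fp p. w(i + 1 := x) \<in> A} = {}")
      case False
      then obtain y where y: "y \<in> Fp p" "w(i + 1 := y) \<in> A" by auto
      have good: "orbit T l w j \<noteq> 0" if "l < n" "j \<in> {i + 1<..m}" for l j
      proof -
        have "orbit T l (w(i + 1 := y)) j \<noteq> 0"
          using y(2) that by (auto simp: A_def bad_def)
        moreover have "orbit T l (w(i + 1 := y)) j = orbit T l w j"
          using that w i y(1) by (intro orbit_depends Fp_points_upd) auto
        ultimately show ?thesis by simp
      qed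
      obtain q where q: "degree q = n * s i" "\<not> int p dvd lead_coeff q"
        "\<And>x. x \<in> Fp p \<Longrightarrow> [slope n i (w(i + 1 := x)) = poly q x] (mod int p)"
        using slope_poly[OF w i good] by blast
      define r where "r = q - 1"
      have "degree q > 0" using q(1) n s_pos[OF i] by simp
      then have r: "degree r = n * s i" "lead_coeff r = lead_coeff q"
        unfolding r_def using q(1) degree_add_eq_left[of "- 1" q] by (simp_all add: coeff_eq_0)
      have "{x \<in> Fp p. w(i + 1 := x) \<in> A} \<subseteq> {x \<in> Fp p. int p dvd poly r x}"
      proof safe
        fix x assume x: "x \<in> Fp p" "w(i + 1 := x) \<in> A"
        then have "[poly q x = 1] (mod int p)"
          using cong_trans[OF cong_sym[OF q(3)[OF x(1)]]] by (simp add: A_def)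
        then show "int p dvd poly r x"
          by (simp add: r_def cong_iff_dvd_diff)
      qed
      then have "card {x \<in> Fp p. w(i + 1 := x) \<in> A} \<le> card {x \<in> Fp p. int p dvd poly r x}"
        by (rule card_mono[rotated]) simp
      also have "\<dots> \<le> n * s i"
        using card_roots_mod_prime_le[OF prime_p, of r] q(2) r by simp
      finally show ?thesis .
    qed (metis card.empty le0)
  qed (use i in \<open>auto simp: A_def\<close>)
  moreover have "card {w \<in> Fp_points p m. [slope n i w = 1] (mod int p)} \<le> card (A \<union> bad)"
    by (rule card_mono) (auto simp: A_def bad_def)
  moreover have "card (A \<union> bad) \<le> card A + card bad"
    by (rule card_Un_le)
  ultimately show ?thesis using bad by (simp add: algebra_simps)
qed

end

section \<open>Exponential sums along orbits\<close>

definition linear_form :: "nat \<Rightarrow> (nat \<Rightarrow> int) \<Rightarrow> (nat \<Rightarrow> int) \<Rightarrow> int" where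
  "linear_form m a v = (\<Sum>j<m. a j * v j)"

text \<open>
  The index \<open>h\<close> is the first one with a nonzero coefficient.  Evaluated along
  the orbit, the linear form depends on the coordinate \<open>h\<close> of the starting point through its
  \<open>h\<close>-th term alone, and this term is affine in it.
\<close>

locale exponential_sums = triangular_permutations +
  fixes a :: "nat \<Rightarrow> int" and h :: nat
  assumes h: "h < m" and a_h: "\<not> int p dvd a h" and a_below: "\<And>j. j < h \<Longrightarrow> a j = 0"
begin

lemma shifted_sums: "exponential_sums p m s (\<lambda>l. T (n + l)) (\<lambda>l. G (n + l)) (\<lambda>l. H (n + l)) a h"
  by (intro exponential_sums.intro shifted exponential_sums_axioms.intro h a_h a_below)

lemma linear_form_split: "linear_form m a v = a h * v h + (\<Sum>j\<in>{h<..<m}. a j * v j)"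
proof -
  have "{..<m} = {..<h} \<union> {h} \<union> {h<..<m}" using h by auto
  then have "linear_form m a v = (\<Sum>j\<in>{..<h} \<union> {h} \<union> {h<..<m}. a j * v j)"
    by (simp add: linear_form_def)
  also have "\<dots> = (\<Sum>j<h. a j * v j) + a h * v h + (\<Sum>j\<in>{h<..<m}. a j * v j)"
    by (subst sum.union_disjoint; (subst sum.union_disjoint)?; auto)
  finally show ?thesis by (simp add: a_below)
qed

text \<open>
  Summing over the coordinate \<open>h\<close> first gives a complete sum of an additive character in the
  frequency \<open>a h * (slope n h w - 1)\<close>.  It vanishes unless the slope is \<open>1\<close>, and the trivial bound
  is used on the few remaining lines.
\<close>

lemma norm_orbit_correlation_le:
  assumes n: "n > 0"
  shows "cmod (\<Sum>w\<in>Fp_points p m. add_char p (linear_form m a (orbit T n w) - linear_form m a w))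
     \<le> real (s h + m) * real n * real p ^ m"
proof -
  define f where "f w = add_char p (linear_form m a (orbit T n w) - linear_form m a w)" for w
  define V where "V = {w \<in> Fp_points p m. [slope n h w = 1] (mod int p)}"
  have fibre: "cmod (\<Sum>x\<in>Fp p. f (w(h := x))) = real p * of_bool (w \<in> V)"
    if w: "w \<in> Fp_points p m" for w
  proof -
    define R where "R = a h * intercept n h w + (\<Sum>j\<in>{h<..<m}. a j * (orbit T n w j - w j))"
    define c where "c = a h * (slope n h w - 1)"
    have "f (w(h := x)) = add_char p R * add_char p (x * c)" if x: "x \<in> Fp p" for x
    proof -
      let ?w = "w(h := x)"
      have wp: "?w \<in> Fp_points p m" using w x h by (simp add: Fp_points_upd)
      have "slope n h ?w = slope n h w" "intercept n h ?w = intercept n h w"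
        using slope_depends[OF wp w, of h n] h by simp_all
      then have lin: "[orbit T n ?w h = x * slope n h w + intercept n h w] (mod int p)"
        using orbit_linear[OF wp, of h n] h by simp
      have rest: "orbit T n ?w j = orbit T n w j" if "j \<in> {h<..<m}" for j
        using that by (intro orbit_depends wp w) simp_all
      have new_sum: "(\<Sum>j\<in>{h<..<m}. a j * orbit T n ?w j) = (\<Sum>j\<in>{h<..<m}. a j * orbit T n w j)"
        by (intro sum.cong) (simp_all only: rest)
      have old_sum: "(\<Sum>j\<in>{h<..<m}. a j * ?w j) = (\<Sum>j\<in>{h<..<m}. a j * w j)"
        by (intro sum.cong) auto
      have phase: "linear_form m a (orbit T n ?w) - linear_form m a ?w =
          a h * orbit T n ?w h - a h * x + (\<Sum>j\<in>{h<..<m}. a j * (orbit T n w j - w j))"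
        by (simp add: linear_form_split old_sum[unfolded fun_upd_apply] new_sum right_diff_distrib sum_subtractf)
      have "[linear_form m a (orbit T n ?w) - linear_form m a ?w =
          a h * (x * slope n h w + intercept n h w) - a h * x
          + (\<Sum>j\<in>{h<..<m}. a j * (orbit T n w j - w j))] (mod int p)"
        unfolding phase by (intro cong_add cong_diff cong_mult cong_refl lin)
      also have "a h * (x * slope n h w + intercept n h w) - a h * x
          + (\<Sum>j\<in>{h<..<m}. a j * (orbit T n w j - w j)) = R + x * c"
        by (simp add: R_def c_def algebra_simps)
      finally show ?thesis
        unfolding f_def add_char_add[symmetric] by (intro add_char_cong) simp
    qed
    then have "(\<Sum>x\<in>Fp p. f (w(h := x))) = add_char p R * (\<Sum>x\<in>Fp p. add_char p (x * c))"
      by (simp add: sum_distrib_left)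
    moreover have "int p dvd c \<longleftrightarrow> w \<in> V"
      using a_h w by (simp add: c_def V_def prime_dvd_mult_iff[OF prime_int] cong_iff_dvd_diff)
    ultimately show ?thesis
      by (simp add: norm_mult sum_add_char)
  qed
  have "real p * cmod (\<Sum>w\<in>Fp_points p m. f w) = cmod (of_nat p * (\<Sum>w\<in>Fp_points p m. f w))"
    by (simp add: norm_mult)
  also have "\<dots> = cmod (\<Sum>w\<in>Fp_points p m. \<Sum>x\<in>Fp p. f (w(h := x)))"
    using sum_over_fibres[of h m f p] h by simp
  also have "\<dots> \<le> (\<Sum>w\<in>Fp_points p m. real p * of_bool (w \<in> V))"
    by (rule order_trans[OF norm_sum]) (simp add: fibre)
  also have "\<dots> = real p * real (card V)"
    by (simp add: V_def Int_def flip: sum_distrib_left)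
  finally have "cmod (\<Sum>w\<in>Fp_points p m. f w) \<le> real (card V)"
    by simp
  also have "\<dots> \<le> real ((s h + m) * n * p ^ m)"
    using card_slope_eq_1[OF h n] unfolding V_def by (simp only: of_nat_le_iff)
  finally show ?thesis by (simp add: f_def)
qed

definition twisted_sum :: "(nat \<Rightarrow> complex) \<Rightarrow> nat \<Rightarrow> (nat \<Rightarrow> int) \<Rightarrow> complex" where
  "twisted_sum b K w = (\<Sum>n<K. b n * add_char p (linear_form m a (orbit T n w)))"

text \<open>
  Opening the square gives the correlations between times \<open>n\<close> and \<open>k\<close>.  The substitution
  \<open>v = orbit T k w\<close>, a bijection, reduces them for \<open>k < n\<close> to a correlation between time \<open>n - k\<close>
  and time \<open>0\<close> for the sequence that starts at \<open>k\<close>.  The first term of the bound comes from the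
  diagonal.
\<close>

lemma mean_square_twisted_sum_le:
  assumes b: "\<And>n. cmod (b n) \<le> 1"
  shows "(\<Sum>w\<in>Fp_points p m. (cmod (twisted_sum b K w))\<^sup>2)
     \<le> real K * real p ^ (m + 1) + real (s h + m) * real K ^ 3 * real p ^ m"
proof -
  let ?P = "Fp_points p m"
  define L where "L n w = linear_form m a (orbit T n w)" for n w
  define C where "C n k = (\<Sum>w\<in>?P. add_char p (L n w - L k w))" for n k
  define Q where "Q = real (s h + m) * real K * real p ^ m"
  have C_gt: "cmod (C n k) \<le> Q" if "k < n" "n < K" for n k
  proof -
    interpret sh: exponential_sums p m s "\<lambda>l. T (k + l)" "\<lambda>l. G (k + l)" "\<lambda>l. H (k + l)" a h
      by (rule shifted_sums)
    let ?g = "\<lambda>v. add_char p (linear_form m a (orbit (\<lambda>l. T (k + l)) (n - k) v) - linear_form m a v)"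
    have "C n k = (\<Sum>w\<in>?P. ?g (orbit T k w))"
      using that by (simp add: C_def L_def flip: orbit_add)
    also have "\<dots> = (\<Sum>v\<in>?P. ?g v)"
      by (rule sum.reindex_bij_betw[OF bij_orbit])
    finally have "cmod (C n k) \<le> real (s h + m) * real (n - k) * real p ^ m"
      using sh.norm_orbit_correlation_le[of "n - k"] that by simp
    also have "\<dots> \<le> Q"
      unfolding Q_def using that by (intro mult_right_mono mult_left_mono) auto
    finally show ?thesis .
  qed
  have C_cnj: "C n k = cnj (C k n)" for n k
    by (simp add: C_def cnj_add_char)
  have "Q \<ge> 0" by (simp add: Q_def)
  have C_le: "cmod (C n k) \<le> (if n = k then real p ^ (m + 1) else 0) + Q" if "n < K" "k < K" for n k
  proof (cases n k rule: linorder_cases)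
    case equal
    then have "C n k = of_nat (card ?P)" by (simp add: C_def)
    then have "cmod (C n k) = real p ^ (m + 1)" by (simp add: card_Fp_points norm_mult norm_power)
    with equal \<open>Q \<ge> 0\<close> show ?thesis by simp
  next
    case less
    then show ?thesis using C_gt[of n k] C_gt[of k n] that C_cnj[of n k] by simp
  next
    case greater
    then show ?thesis using C_gt[of k n] that by simp
  qed
  have square: "complex_of_real ((cmod (twisted_sum b K w))\<^sup>2) =
      (\<Sum>n<K. \<Sum>k<K. b n * cnj (b k) * add_char p (L n w - L k w))" for w
  proof -
    have "complex_of_real ((cmod (twisted_sum b K w))\<^sup>2) = twisted_sum b K w * cnj (twisted_sum b K w)"
      by (rule complex_norm_square)
    also have "\<dots> = (\<Sum>n<K. \<Sum>k<K. (b n * add_char p (L n w)) * (cnj (b k) * cnj (add_char p (L k w))))"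
      by (simp add: twisted_sum_def L_def sum_product)
    also have "\<dots> = (\<Sum>n<K. \<Sum>k<K. b n * cnj (b k) * add_char p (L n w - L k w))"
    proof (intro sum.cong refl)
      fix n k
      have "add_char p (L n w - L k w) = add_char p (L n w) * add_char p (- L k w)"
        using add_char_add[of p "L n w" "- L k w"] by simp
      then show "(b n * add_char p (L n w)) * (cnj (b k) * cnj (add_char p (L k w)))
          = b n * cnj (b k) * add_char p (L n w - L k w)"
        by (simp add: cnj_add_char)
    qed
    finally show ?thesis .
  qed
  have "complex_of_real (\<Sum>w\<in>?P. (cmod (twisted_sum b K w))\<^sup>2) =
      (\<Sum>w\<in>?P. \<Sum>n<K. \<Sum>k<K. b n * cnj (b k) * add_char p (L n w - L k w))"
    by (simp only: of_real_sum square)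
  also have "\<dots> = (\<Sum>n<K. \<Sum>w\<in>?P. \<Sum>k<K. b n * cnj (b k) * add_char p (L n w - L k w))"
    by (rule sum.swap)
  also have "\<dots> = (\<Sum>n<K. \<Sum>k<K. \<Sum>w\<in>?P. b n * cnj (b k) * add_char p (L n w - L k w))"
    by (intro sum.cong refl sum.swap)
  also have "\<dots> = (\<Sum>n<K. \<Sum>k<K. b n * cnj (b k) * C n k)"
    by (simp only: C_def sum_distrib_left)
  finally have eq: "complex_of_real (\<Sum>w\<in>?P. (cmod (twisted_sum b K w))\<^sup>2) =
      (\<Sum>n<K. \<Sum>k<K. b n * cnj (b k) * C n k)" .
  have "(\<Sum>w\<in>?P. (cmod (twisted_sum b K w))\<^sup>2) = cmod (\<Sum>n<K. \<Sum>k<K. b n * cnj (b k) * C n k)"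
    unfolding eq[symmetric] norm_of_real by (simp add: sum_nonneg)
  also have "\<dots> \<le> (\<Sum>n<K. \<Sum>k<K. cmod (b n * cnj (b k) * C n k))"
    by (intro order_trans[OF norm_sum] sum_mono) simp
  also have "\<dots> \<le> (\<Sum>n<K. \<Sum>k<K. (if n = k then real p ^ (m + 1) else 0) + Q)"
  proof (intro sum_mono)
    fix n k assume "n \<in> {..<K}" "k \<in> {..<K}"
    then have "cmod (C n k) \<le> (if n = k then real p ^ (m + 1) else 0) + Q"
      using C_le by simp
    moreover have "cmod (b n * cnj (b k)) \<le> 1"
      using mult_mono[OF b[of n] b[of k]] by (simp add: norm_mult)
    ultimately show "cmod (b n * cnj (b k) * C n k) \<le> (if n = k then real p ^ (m + 1) else 0) + Q"
      unfolding norm_mult[of "b n * cnj (b k)"]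
      using mult_mono[of "cmod (b n * cnj (b k))" 1 "cmod (C n k)"] by fastforce
  qed
  also have "\<dots> = real K * real p ^ (m + 1) + real K * (real K * Q)"
    by (simp add: sum.distrib distrib_left)
  also have "\<dots> = real K * real p ^ (m + 1) + real (s h + m) * real K ^ 3 * real p ^ m"
    by (simp add: Q_def power3_eq_cube algebra_simps)
  finally show ?thesis .
qed

text \<open>
  Cutting the range into \<open>B\<close> blocks of length \<open>K\<close> and applying Cauchy's inequality; each block is,
  after the bijective substitution \<open>v = orbit T (l * K) w\<close>, a sum of the same kind.  Weights bounded
  by \<open>1\<close> may be set to zero, so the last block need not be complete.
\<close>

lemma mean_square_twisted_sum_blocks_le:
  assumes b: "\<And>n. cmod (b n) \<le> 1" and N: "N \<le> B * K"
  shows "(\<Sum>w\<in>Fp_points p m. (cmod (twisted_sum b N w))\<^sup>2)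
     \<le> (real B)\<^sup>2 * (real K * real p ^ (m + 1) + real (s h + m) * real K ^ 3 * real p ^ m)"
proof -
  let ?P = "Fp_points p m"
  let ?M = "real K * real p ^ (m + 1) + real (s h + m) * real K ^ 3 * real p ^ m"
  define b' where "b' n = (if n < N then b n else 0)" for n
  have b': "cmod (b' n) \<le> 1" for n using b by (simp add: b'_def)
  define D where "D l w = (\<Sum>n<K. b' (l * K + n) * add_char p (linear_form m a (orbit T (l * K + n) w)))" for l w
  have D: "(\<Sum>w\<in>?P. (cmod (D l w))\<^sup>2) \<le> ?M" for l
  proof -
    interpret sh: exponential_sums p m s "\<lambda>n. T (l * K + n)" "\<lambda>n. G (l * K + n)" "\<lambda>n. H (l * K + n)" a h
      by (rule shifted_sums)
    let ?S = "sh.twisted_sum (\<lambda>n. b' (l * K + n)) K"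
    have "(\<Sum>w\<in>?P. (cmod (D l w))\<^sup>2) = (\<Sum>w\<in>?P. (cmod (?S (orbit T (l * K) w)))\<^sup>2)"
      by (simp add: D_def sh.twisted_sum_def orbit_add)
    also have "\<dots> = (\<Sum>v\<in>?P. (cmod (?S v))\<^sup>2)"
      by (rule sum.reindex_bij_betw[OF bij_orbit])
    also have "\<dots> \<le> ?M"
      by (rule sh.mean_square_twisted_sum_le) (rule b')
    finally show ?thesis .
  qed
  have split: "twisted_sum b N w = (\<Sum>l<B. D l w)" for w
  proof -
    let ?t = "\<lambda>n. b' n * add_char p (linear_form m a (orbit T n w))"
    have "twisted_sum b N w = (\<Sum>n<N. ?t n)"
      by (simp add: twisted_sum_def b'_def)
    also have "\<dots> = (\<Sum>n<B * K. ?t n)"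
      using N by (intro sum.mono_neutral_left) (auto simp: b'_def)
    also have "\<dots> = (\<Sum>l<B. sum ?t {l * K..<l * K + K})"
      by (simp only: sum.nat_group)
    also have "\<dots> = (\<Sum>l<B. D l w)"
    proof (rule sum.cong[OF refl])
      fix l
      show "sum ?t {l * K..<l * K + K} = D l w"
        unfolding D_def
        by (rule sum.reindex_bij_witness[where i = "\<lambda>n. l * K + n" and j = "\<lambda>n. n - l * K"]) auto
    qed
    finally show ?thesis .
  qed
  have "(\<Sum>w\<in>?P. (cmod (twisted_sum b N w))\<^sup>2) \<le> (\<Sum>w\<in>?P. real B * (\<Sum>l<B. (cmod (D l w))\<^sup>2))"
  proof (rule sum_mono)
    fix w
    have "(cmod (twisted_sum b N w))\<^sup>2 \<le> (\<Sum>l<B. cmod (D l w))\<^sup>2"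
      unfolding split by (intro power_mono norm_sum) simp
    also have "\<dots> \<le> (\<Sum>l<B. (cmod (D l w))\<^sup>2) * real (card {..<B})"
      by (rule sum_squared_le_sum_of_squares)
    finally show "(cmod (twisted_sum b N w))\<^sup>2 \<le> real B * (\<Sum>l<B. (cmod (D l w))\<^sup>2)"
      by (simp add: mult.commute)
  qed
  also have "\<dots> = real B * (\<Sum>l<B. \<Sum>w\<in>?P. (cmod (D l w))\<^sup>2)"
    by (subst sum.swap) (simp only: sum_distrib_left)
  also have "\<dots> \<le> real B * (\<Sum>l<B. ?M)"
    by (intro mult_left_mono sum_mono D) simp
  also have "\<dots> = (real B)\<^sup>2 * ?M"
    by (simp add: power2_eq_square)
  finally show ?thesis .
qed

end

text \<open>
  The choice of the block length.  While \<open>K \<le> p powr (1 / (m + 1))\<close>, also \<open>K\<^sup>2 \<le> p\<close> because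
  \<open>m + 1 \<ge> 2\<close>, and the diagonal term dominates in the bound for \<open>V\<close>.  For larger \<open>N\<close> the blocks have the
  length \<open>p powr (1 / (m + 1))\<close>, rounded down.  The factor \<open>8\<close> pays for this rounding (\<open>2\<close>) and
  for rounding the number of blocks up (\<open>2\<^sup>2\<close>).
\<close>

lemma le_A_bound:
  fixes V C :: real
  assumes "m \<ge> 1" "p > 0" "N > 0" "C \<ge> 0"
    and V: "\<And>B K. N \<le> B * K \<Longrightarrow>
      V \<le> (real B)\<^sup>2 * (real K * real p ^ (m + 1) + C * real K ^ 3 * real p ^ m)"
  shows "V \<le> 8 * (1 + C) * A_bound m N p"
proof -
  define X where "X = real p powr (1 / (real m + 1))"
  have "X \<ge> 1" using assms(1,2) by (simp add: X_def ge_one_powr_ge_zero)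
  have X_pow: "X ^ (m + 1) = real p"
  proof -
    have "X ^ (m + 1) = X powr real (m + 1)"
      using \<open>X \<ge> 1\<close> by (simp only: powr_realpow)
    also have "\<dots> = real p powr 1"
    proof -
      have "1 / (real m + 1) * real (m + 1) = 1" by simp
      then show ?thesis unfolding X_def powr_powr by (simp only:)
    qed
    finally show ?thesis using assms(2) by simp
  qed
  have short: "real K * real p ^ (m + 1) + C * real K ^ 3 * real p ^ m
      \<le> (1 + C) * (real K * real p ^ (m + 1))" if K: "real K \<le> X" for K
  proof -
    have "(real K)\<^sup>2 \<le> X\<^sup>2" using K by (intro power_mono) auto
    also have "\<dots> \<le> X ^ (m + 1)" using \<open>X \<ge> 1\<close> assms(1) by (intro power_increasing) auto
    finally have "(real K)\<^sup>2 \<le> real p" by (simp only: X_pow)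
    then have "C * real K * real p ^ m * (real K)\<^sup>2 \<le> C * real K * real p ^ m * real p"
      using assms(4) by (intro mult_left_mono) auto
    then show ?thesis by (simp add: algebra_simps power2_eq_square power3_eq_cube)
  qed
  show ?thesis
  proof (cases "real N \<le> X")
    case True
    have "V \<le> (1 + C) * (real N * real p ^ (m + 1))"
      using V[of 1 N] short[OF True] by simp
    also have "\<dots> \<le> 8 * ((1 + C) * (real N * real p ^ (m + 1)))"
      using assms(4) by simp
    also have "real N * real p ^ (m + 1) = A_bound m N p"
      using True by (simp add: A_bound_def X_def)
    finally show ?thesis by (simp only: mult.assoc)
  next
    case False
    define K where "K = nat \<lfloor>X\<rfloor>"
    define B where "B = N div K + 1"
    have K: "real K \<le> X" "X < real K + 1" "K \<ge> 1"
      using \<open>X \<ge> 1\<close> by (auto simp: K_def le_nat_iff le_floor_iff)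
    have "N \<le> B * K"
      using K(3) dividend_less_div_times[of K N] by (simp add: B_def algebra_simps)
    have "real (N div K) \<le> real N / real K" by (rule of_nat_div_le_of_nat)
    moreover have "1 \<le> real N / real K" using False K by simp
    ultimately have B: "real B \<le> 2 * (real N / real K)" by (simp add: B_def)
    have inverse_K: "1 / real K \<le> 2 / X"
    proof -
      have "1 \<le> real K" using K(3) by simp
      then have "X \<le> 2 * real K" using K(2) by linarith
      then show ?thesis using \<open>1 \<le> real K\<close> \<open>X \<ge> 1\<close> by (simp add: field_simps)
    qed
    have "real p ^ (m + 1) / X = real p powr (real (m + 1) - 1 / (real m + 1))"
      using assms(2) by (simp only: X_def powr_diff powr_realpow of_nat_0_less_iff)
    also have "real (m + 1) - 1 / (real m + 1) = real m * (real m + 2) / (real m + 1)"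
      by (simp add: field_simps)
    finally have exponent: "real p ^ (m + 1) / X = real p powr (real m * (real m + 2) / (real m + 1))" .
    have "V \<le> (real B)\<^sup>2 * ((1 + C) * (real K * real p ^ (m + 1)))"
      using V[OF \<open>N \<le> B * K\<close>] mult_left_mono[OF short[OF K(1)], of "(real B)\<^sup>2"] by simp
    also have "\<dots> \<le> (2 * (real N / real K))\<^sup>2 * ((1 + C) * (real K * real p ^ (m + 1)))"
      using B assms(4) by (intro mult_right_mono power_mono) auto
    also have "\<dots> = 4 * (1 + C) * (real N)\<^sup>2 * real p ^ (m + 1) * (1 / real K)"
      using K(3) by (simp add: field_simps power2_eq_square)
    also have "\<dots> \<le> 4 * (1 + C) * (real N)\<^sup>2 * real p ^ (m + 1) * (2 / X)"
      using assms(4) by (intro mult_left_mono inverse_K) auto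
    also have "\<dots> = 8 * (1 + C) * ((real N)\<^sup>2 * (real p ^ (m + 1) / X))"
      by simp
    also have "\<dots> = 8 * (1 + C) * A_bound m N p"
      using False unfolding exponent by (simp add: A_bound_def X_def)
    finally show ?thesis .
  qed
qed

section \<open>Polynomial systems as triangular permutations\<close>

lemma insertion_depends:
  assumes "P \<in> Fp_polys p V" "\<And>j. j \<in> V \<Longrightarrow> x j = y j"
  shows "insertion x P = insertion y P"
  using assms by (intro insertion_cong) (auto simp: Fp_polys_def)

lemma insertion_univariate:
  fixes w :: "nat \<Rightarrow> int"
  assumes "\<And>t. t \<in> Poly_Mapping.keys P \<Longrightarrow> Poly_Mapping.lookup t j < d"
  shows "\<exists>q. (\<forall>n\<ge>d. coeff q n = 0) \<and> (\<forall>x. insertion (w(j := x)) P = poly q x)"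
proof -
  define c where "c t = Poly_Mapping.lookup P t *
    (\<Prod>i\<in>Poly_Mapping.keys t - {j}. w i ^ Poly_Mapping.lookup t i)" for t
  define q where "q = (\<Sum>t\<in>Poly_Mapping.keys P. monom (c t) (Poly_Mapping.lookup t j))"
  have "insertion (w(j := x)) P = poly q x" for x
  proof -
    have "monomial_value (w(j := x)) t = x ^ Poly_Mapping.lookup t j *
        (\<Prod>i\<in>Poly_Mapping.keys t - {j}. w i ^ Poly_Mapping.lookup t i)" for t
    proof -
      have "monomial_value (w(j := x)) t =
          (\<Prod>i\<in>insert j (Poly_Mapping.keys t). (w(j := x)) i ^ Poly_Mapping.lookup t i)"
        by (rule monomial_value_superset) auto
      also have "\<dots> = x ^ Poly_Mapping.lookup t j *
          (\<Prod>i\<in>Poly_Mapping.keys t - {j}. (w(j := x)) i ^ Poly_Mapping.lookup t i)"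
        by (simp add: prod.insert_remove)
      also have "(\<Prod>i\<in>Poly_Mapping.keys t - {j}. (w(j := x)) i ^ Poly_Mapping.lookup t i) =
          (\<Prod>i\<in>Poly_Mapping.keys t - {j}. w i ^ Poly_Mapping.lookup t i)"
        by (intro prod.cong) auto
      finally show ?thesis .
    qed
    then show ?thesis
      by (simp add: insertion_superset[of "Poly_Mapping.keys P"] q_def c_def poly_sum poly_monom
          mult_ac)
  qed
  moreover have "coeff q n = 0" if "n \<ge> d" for n
    unfolding q_def coeff_sum using assms that by (intro sum.neutral ballI) (fastforce simp: coeff_monom)
  ultimately show ?thesis by blast
qed

lemma lookup_less_of_deg_in:
  assumes "deg_in j P < ereal (real d)" "t \<in> Poly_Mapping.keys P"
  shows "Poly_Mapping.lookup t j < d"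
proof -
  have "ereal (real (Poly_Mapping.lookup t j)) \<le> deg_in j P"
    unfolding deg_in_def by (rule SUP_upper) (rule assms(2))
  with assms(1) show ?thesis by (metis ereal_less_eq(3) less_ereal.simps(1) not_le of_nat_less_iff order_le_less_trans)
qed

text \<open>
  On a line in direction \<open>i + 1\<close> the coefficient of \<open>X ^ e (i + 1)\<close> comes from the leading
  monomial alone, because \<open>Gt\<close> has a smaller degree in that variable.
\<close>

lemma leading_monomial_univariate:
  fixes w :: "nat \<Rightarrow> int"
  assumes p: "prime p" and w: "w \<in> Fp_points p m" and i: "i < m"
    and nz: "\<And>j. j \<in> {i + 1<..m} \<Longrightarrow> w j \<noteq> 0" and g: "\<not> int p dvd g"
    and G: "G = reduce p (Const g * (\<Prod>j\<in>{i<..m}. Var j ^ e j) + Gt)"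
    and deg: "\<And>t. t \<in> Poly_Mapping.keys Gt \<Longrightarrow> Poly_Mapping.lookup t (i + 1) < e (i + 1)"
  shows "\<exists>q. degree q = e (i + 1) \<and> \<not> int p dvd lead_coeff q \<and>
     (\<forall>x. [insertion (w(i + 1 := x)) G = poly q x] (mod int p))"
proof -
  obtain r where r: "\<And>n. n \<ge> e (i + 1) \<Longrightarrow> coeff r n = 0"
    "\<And>x. insertion (w(i + 1 := x)) Gt = poly r x"
    using insertion_univariate[of Gt "i + 1" "e (i + 1)" w] deg by blast
  define c where "c = g * (\<Prod>j\<in>{i + 1<..m}. w j ^ e j)"
  define q where "q = monom c (e (i + 1)) + r"
  have prime_int: "prime (int p)" using p by simp
  have "\<not> int p dvd w j" if "j \<in> {i + 1<..m}" for j
    using not_dvd_of_Fp[OF Fp_points_Fp[OF w] nz[OF that]] that by simp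
  then have "\<not> int p dvd w j ^ e j" if "j \<in> {i + 1<..m}" for j
    using that prime_dvd_power[OF prime_int] by blast
  then have c: "\<not> int p dvd c"
    using g by (simp add: c_def prime_dvd_mult_iff[OF prime_int] prime_dvd_prod_iff[OF _ prime_int])
  then have "c \<noteq> 0" by auto
  have coeff_q: "coeff q (e (i + 1)) = c" by (simp add: q_def r(1))
  have "degree q \<le> e (i + 1)"
    unfolding q_def using r(1) by (intro degree_le allI impI) (simp add: coeff_monom)
  moreover have "e (i + 1) \<le> degree q"
    using coeff_q \<open>c \<noteq> 0\<close> by (intro le_degree) simp
  ultimately have degree_q: "degree q = e (i + 1)" by simp
  have "[insertion (w(i + 1 := x)) G = poly q x] (mod int p)" for x
  proof -
    have "{i<..m} = insert (i + 1) {i + 1<..m}" using i by auto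
    then have "(\<Prod>j\<in>{i<..m}. (w(i + 1 := x)) j ^ e j) =
        x ^ e (i + 1) * (\<Prod>j\<in>{i + 1<..m}. (w(i + 1 := x)) j ^ e j)" by simp
    also have "(\<Prod>j\<in>{i + 1<..m}. (w(i + 1 := x)) j ^ e j) = (\<Prod>j\<in>{i + 1<..m}. w j ^ e j)"
      by (intro prod.cong) auto
    finally have "insertion (w(i + 1 := x)) (Const g * (\<Prod>j\<in>{i<..m}. Var j ^ e j) + Gt) = poly q x"
      using r(2)[of x] by (simp add: q_def c_def poly_monom mult_ac)
    then show ?thesis
      using insertion_reduce[of "w(i + 1 := x)" p] unfolding G by metis
  qed
  with degree_q coeff_q c show ?thesis by auto
qed

text \<open>
  The last component also has the shape of the others, with constant \<open>G\<close> and \<open>H\<close>, so that all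
  components can be treated alike.
\<close>

lemma poly_systemsE:
  assumes F: "F \<in> poly_systems p S m"
  obtains G H where
    "\<And>i. i \<le> m \<Longrightarrow> G i \<in> Fp_polys p {i<..m}" "\<And>i. i \<le> m \<Longrightarrow> H i \<in> Fp_polys p {i<..m}"
    "\<And>i. i \<le> m \<Longrightarrow> F i = reduce p (Var i * G i + H i)"
    "\<And>i. i < m \<Longrightarrow> \<exists>g Gt. g \<in> Fp p \<and> g \<noteq> 0 \<and>
       G i = reduce p (Const g * (\<Prod>j\<in>{i<..m}. Var j ^ (S $$ (i, j))) + Gt) \<and>
       (\<forall>j\<in>{i<..m}. deg_in j Gt < ereal (real (S $$ (i, j))))"
proof -
  define R where "R i G H \<longleftrightarrow> G \<in> Fp_polys p {i<..m} \<and> H \<in> Fp_polys p {i<..m} \<and>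
    F i = reduce p (Var i * G + H) \<and>
    (i < m \<longrightarrow> (\<exists>g Gt. g \<in> Fp p \<and> g \<noteq> 0 \<and>
       G = reduce p (Const g * (\<Prod>j\<in>{i<..m}. Var j ^ (S $$ (i, j))) + Gt) \<and>
       (\<forall>j\<in>{i<..m}. deg_in j Gt < ereal (real (S $$ (i, j))))))" for i G H
  have "\<exists>G H. R i G H" if i: "i \<le> m" for i
  proof (cases "i < m")
    case True
    with F obtain G H g Gt where
      "G \<in> Fp_polys p {i<..m}" "H \<in> Fp_polys p {i<..m}" "g \<in> Fp p" "g \<noteq> 0"
      "F i = reduce p (Var i * G + H)"
      "G = reduce p (Const g * (\<Prod>j\<in>{i<..m}. Var j ^ (S $$ (i, j))) + Gt)"
      "\<forall>j\<in>{i<..m}. deg_in j Gt < ereal (real (S $$ (i, j)))"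
      unfolding poly_systems_def by blast
    then show ?thesis unfolding R_def by blast
  next
    case False
    with i have [simp]: "i = m" by simp
    obtain g h where gh: "g \<in> Fp p" "h \<in> Fp p" "F m = reduce p (Const g * Var m + Const h)"
      using F unfolding poly_systems_def by auto
    have const: "Const c \<in> Fp_polys p {m<..m}" if "c \<in> Fp p" for c
      using that by (auto simp: Fp_polys_def Const_def lookup_single when_def Fp_def split: if_splits)
    show ?thesis
      by (intro exI[of _ "Const g"] exI[of _ "Const h"])
        (use const gh in \<open>simp_all add: R_def mult.commute\<close>)
  qed
  then obtain G H where "\<And>i. i \<le> m \<Longrightarrow> R i (G i) (H i)" by metis
  then show thesis
    by (intro that[of G H]) (simp_all add: R_def)
qed

lemma poly_systems_triangular:
  assumes p: "prime p" and F: "F \<in> poly_systems p S m"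
  shows "\<exists>G H. triangular_map p m (\<lambda>i. S $$ (i, i + 1)) (\<lambda>w. \<lambda>i\<in>{..m}. Fp_eval p (F i) w) G H"
proof -
  obtain G H where GH:
    "\<And>i. i \<le> m \<Longrightarrow> G i \<in> Fp_polys p {i<..m}" "\<And>i. i \<le> m \<Longrightarrow> H i \<in> Fp_polys p {i<..m}"
    "\<And>i. i \<le> m \<Longrightarrow> F i = reduce p (Var i * G i + H i)"
    "\<And>i. i < m \<Longrightarrow> \<exists>g Gt. g \<in> Fp p \<and> g \<noteq> 0 \<and>
       G i = reduce p (Const g * (\<Prod>j\<in>{i<..m}. Var j ^ (S $$ (i, j))) + Gt) \<and>
       (\<forall>j\<in>{i<..m}. deg_in j Gt < ereal (real (S $$ (i, j))))"
    by (rule poly_systemsE[OF F]) blast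
  have "triangular_map p m (\<lambda>i. S $$ (i, i + 1)) (\<lambda>w. \<lambda>i\<in>{..m}. Fp_eval p (F i) w)
      (\<lambda>i w. insertion w (G i)) (\<lambda>i w. insertion w (H i))"
    unfolding triangular_map_def
  proof (intro conjI ballI allI impI)
    fix w i assume "i \<le> m"
    then show "[(\<lambda>i\<in>{..m}. Fp_eval p (F i) w) i = w i * insertion w (G i) + insertion w (H i)] (mod int p)"
      using insertion_reduce[of w p "Var i * G i + H i"] by (simp add: Fp_eval_def GH(3) cong_def)
  next
    fix w w' :: "nat \<Rightarrow> int" and i assume "i \<le> m" "\<forall>j\<in>{i<..m}. w j = w' j"
    then show "insertion w (G i) = insertion w' (G i)" "insertion w (H i) = insertion w' (H i)"
      using insertion_depends GH(1,2) by blast+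
  next
    fix w i assume w: "w \<in> Fp_points p m" and i: "i < m" and nz: "\<forall>j\<in>{i + 1<..m}. w j \<noteq> 0"
    obtain g Gt where g: "g \<in> Fp p" "g \<noteq> 0"
      and Gi: "G i = reduce p (Const g * (\<Prod>j\<in>{i<..m}. Var j ^ (S $$ (i, j))) + Gt)"
      and deg: "\<forall>j\<in>{i<..m}. deg_in j Gt < ereal (real (S $$ (i, j)))"
      using GH(4)[OF i] by blast
    have "\<not> int p dvd g" by (rule not_dvd_of_Fp[OF g])
    moreover have "deg_in (i + 1) Gt < ereal (real (S $$ (i, i + 1)))" using deg i by simp
    ultimately have "\<exists>q. degree q = S $$ (i, i + 1) \<and> \<not> int p dvd lead_coeff q \<and>
       (\<forall>x. [insertion (w(i + 1 := x)) (G i) = poly q x] (mod int p))"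
      by (intro leading_monomial_univariate[OF p w i _ _ Gi] lookup_less_of_deg_in) (use nz in auto)
    then show "\<exists>q. degree q = S $$ (i, i + 1) \<and> \<not> int p dvd lead_coeff q \<and>
       (\<forall>x\<in>Fp p. [insertion (w(i + 1 := x)) (G i) = poly q x] (mod int p))" by blast
  qed
  then show ?thesis by blast
qed

text \<open>
  Substituting a whole family into a system, as the iteration does, also substitutes members of
  index above \<open>m\<close>, about which nothing is known.  The variables of a system have index at most
  \<open>m\<close>, so agreement up to \<open>m\<close> suffices for equal values.
\<close>

lemma Fp_eval_poly_system_cong:
  assumes F: "F \<in> poly_systems p S m" and i: "i \<le> m" and xy: "\<And>j. j \<le> m \<Longrightarrow> [x j = y j] (mod int p)"
  shows "Fp_eval p (F i) x = Fp_eval p (F i) y"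
proof -
  obtain G H where GH: "G \<in> Fp_polys p {i<..m}" "H \<in> Fp_polys p {i<..m}"
    "F i = reduce p (Var i * G + H)"
    by (rule poly_systemsE[OF F]) (use i in blast)
  have "[insertion x P = insertion y P] (mod int p)" if P: "P \<in> Fp_polys p {i<..m}" for P
  proof -
    define z where "z j = (if j \<le> m then y j else x j)" for j
    have "[insertion x P = insertion z P] (mod int p)"
      using xy by (intro insertion_cong_mod) (simp add: z_def)
    moreover have "insertion z P = insertion y P"
      using P by (rule insertion_depends) (simp add: z_def)
    ultimately show ?thesis by simp
  qed
  then have "[insertion x (Var i * G + H) = insertion y (Var i * G + H)] (mod int p)"
    using GH(1,2) xy[OF i] by (simp add: cong_add cong_mult)
  then have "[insertion x (F i) = insertion y (F i)] (mod int p)"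
    unfolding GH(3) by (meson cong_trans cong_sym insertion_reduce)
  then show ?thesis by (simp add: Fp_eval_def cong_def)
qed

lemma Fp_eval_iterated:
  assumes F: "\<And>k. Fs (Suc k) \<in> poly_systems p S m"
    and T: "\<And>k w. T k w = (\<lambda>i\<in>{..m}. Fp_eval p (Fs (Suc k) i) w)"
    and w: "w \<in> Fp_points p m" and i: "i \<le> m"
  shows "Fp_eval p (iterated p Fs n i) w = orbit T n w i"
  using i
proof (induction n arbitrary: i)
  case 0
  then show ?case
    using Fp_points_Fp[OF w 0] by (simp add: Fp_eval_def Fp_def)
next
  case (Suc n)
  let ?Q = "iterated p Fs n"
  let ?v = "orbit T n w"
  have "Fp_eval p (iterated p Fs (Suc n) i) w = insertion w (insertion ?Q (Fs (Suc n) i)) mod int p"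
    using insertion_reduce[of w p "insertion ?Q (Fs (Suc n) i)"]
    by (simp add: Fp_eval_def Fp_comp_def cong_def)
  also have "\<dots> = Fp_eval p (Fs (Suc n) i) (\<lambda>j. insertion w (?Q j))"
    by (simp add: Fp_eval_def insertion_insertion)
  also have "\<dots> = Fp_eval p (Fs (Suc n) i) ?v"
  proof (rule Fp_eval_poly_system_cong[OF F Suc.prems])
    fix j assume "j \<le> m"
    then have "insertion w (?Q j) mod int p = ?v j"
      using Suc.IH[of j] by (simp only: Fp_eval_def)
    then show "[insertion w (?Q j) = ?v j] (mod int p)"
      by (metis cong_mod_right cong_refl)
  qed
  also have "\<dots> = T n ?v i"
    unfolding T[of n ?v] using Suc.prems by simp
  finally show ?case by simp
qed

section \<open>The mean square bound\<close>

theorem theorem8: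
  fixes m :: nat and S :: "nat mat"
  assumes "m \<ge> 1"
    and "exponent_matrix S m"
    and "(\<Prod>i<m. S $$ (i, i + 1)) \<noteq> 0"
  shows "\<exists>C::real. C > 0 \<and>
    (\<forall>(p::nat) (Fs :: nat \<Rightarrow> nat \<Rightarrow> int_mpoly) (c::nat) (M::nat) (N::nat) (a :: nat \<Rightarrow> int).
       prime p \<longrightarrow>
       (\<forall>k\<ge>1. Fs k \<in> poly_systems p S m \<and> permutation_system p m (Fs k)) \<longrightarrow>
       c > 0 \<longrightarrow> M > 0 \<longrightarrow> N > 0 \<longrightarrow>
       (\<forall>j<m. a j \<in> Fp p) \<longrightarrow> (\<exists>j<m. a j \<noteq> 0) \<longrightarrow>
       (\<Sum>w\<in>Fp_points p m.
          (cmod (\<Sum>n<N. add_char p (\<Sum>j<m. a j * Fp_eval p (iterated p Fs n j) w)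
                        * add_char M (int c * int n)))\<^sup>2)
       \<le> C * A_bound m N p)"
proof -
  define s where "s i = S $$ (i, i + 1)" for i
  \<comment> \<open>A bound for \<open>s h + m\<close> that does not depend on the first index \<open>h\<close> with \<open>a h \<noteq> 0\<close>.\<close>
  define C where "C = real ((\<Sum>i<m. s i) + m)"
  have "C \<ge> 0" unfolding C_def by (rule of_nat_0_le_iff)
  have bound: "(\<Sum>w\<in>Fp_points p m.
          (cmod (\<Sum>n<N. add_char p (\<Sum>j<m. a j * Fp_eval p (iterated p Fs n j) w)
                        * add_char M (int c * int n)))\<^sup>2)
       \<le> 8 * (1 + C) * A_bound m N p"
    if p: "prime p" and Fs: "\<forall>k\<ge>1. Fs k \<in> poly_systems p S m \<and> permutation_system p m (Fs k)"
      and "N > 0" and a: "\<forall>j<m. a j \<in> Fp p" "\<exists>j<m. a j \<noteq> 0"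
    for p Fs c M N a
  proof -
    have sys: "Fs (Suc k) \<in> poly_systems p S m" for k using Fs by simp
    \<comment> \<open>The systems are numbered from \<open>1\<close>, the maps that generate the orbit from \<open>0\<close>.\<close>
    define T where "T k w = (\<lambda>i\<in>{..m}. Fp_eval p (Fs (Suc k) i) w)" for k w
    have "\<exists>G H. triangular_map p m s (T k) G H" for k
      using poly_systems_triangular[OF p sys, of k] unfolding s_def T_def .
    then obtain G H where tri: "\<And>k. triangular_map p m s (T k) (G k) (H k)"
      by metis
    have bij: "bij_betw (T k) (Fp_points p m) (Fp_points p m)" for k
      using Fs unfolding permutation_system_def T_def by simp
    have s_pos: "s i > 0" if "i < m" for i
      using assms(3) that by (simp add: s_def)
    define h where "h = (LEAST j. j < m \<and> a j \<noteq> 0)"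
    have h: "h < m" "a h \<noteq> 0"
      using LeastI_ex[of "\<lambda>j. j < m \<and> a j \<noteq> 0"] a(2) unfolding h_def by auto
    have below: "a j = 0" if "j < h" for j
      using not_less_Least[of j "\<lambda>j. j < m \<and> a j \<noteq> 0"] that h(1) unfolding h_def by auto
    have a_h: "\<not> int p dvd a h"
      using a(1) h by (intro not_dvd_of_Fp) auto
    interpret exponential_sums p m s T G H a h
      by unfold_locales (use p s_pos bij tri h below a_h in auto)
    define b where "b n = add_char M (int c * int n)" for n
    have b: "cmod (b n) \<le> 1" for n by (simp add: b_def)
    have "s h \<le> (\<Sum>i<m. s i)" using h by (intro member_le_sum) auto
    then have "s h + m \<le> (\<Sum>i<m. s i) + m" by simp
    then have C: "real (s h + m) \<le> C" unfolding C_def by (simp only: of_nat_le_iff)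
    have iter: "Fp_eval p (iterated p Fs n j) w = orbit T n w j"
      if "w \<in> Fp_points p m" "j < m" for w n j
      using that by (intro Fp_eval_iterated[where Fs = Fs, OF sys T_def]) simp_all
    have "(\<Sum>w\<in>Fp_points p m. (cmod (twisted_sum b N w))\<^sup>2) \<le> 8 * (1 + C) * A_bound m N p"
    proof (rule le_A_bound)
      fix B K assume "N \<le> B * K"
      then have "(\<Sum>w\<in>Fp_points p m. (cmod (twisted_sum b N w))\<^sup>2)
         \<le> (real B)\<^sup>2 * (real K * real p ^ (m + 1) + real (s h + m) * real K ^ 3 * real p ^ m)"
        by (rule mean_square_twisted_sum_blocks_le[OF b])
      also have "\<dots> \<le> (real B)\<^sup>2 * (real K * real p ^ (m + 1) + C * real K ^ 3 * real p ^ m)"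
        by (intro mult_left_mono add_left_mono mult_right_mono C) auto
      finally show "(\<Sum>w\<in>Fp_points p m. (cmod (twisted_sum b N w))\<^sup>2)
         \<le> (real B)\<^sup>2 * (real K * real p ^ (m + 1) + C * real K ^ 3 * real p ^ m)" .
    qed (use assms(1) \<open>N > 0\<close> p_pos \<open>C \<ge> 0\<close> in auto)
    moreover have "twisted_sum b N w =
        (\<Sum>n<N. add_char p (\<Sum>j<m. a j * Fp_eval p (iterated p Fs n j) w) * add_char M (int c * int n))"
      if "w \<in> Fp_points p m" for w
    proof -
      have "(\<Sum>j<m. a j * Fp_eval p (iterated p Fs n j) w) = linear_form m a (orbit T n w)" for n
        unfolding linear_form_def by (intro sum.cong refl) (simp add: iter[OF that])
      then show ?thesis by (simp add: twisted_sum_def b_def mult.commute)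
    qed
    ultimately show ?thesis by simp
  qed
  show ?thesis
    using \<open>C \<ge> 0\<close> by (intro exI[of _ "8 * (1 + C)"] conjI allI impI bound) auto
qed

end
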